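(* Let $\mathcal V\subset \mathfrak{sl}(N,\mathbb C)$ be a hypersurface orbital variety, and let $\mathcal V_R$ be the Richardson orbital variety with $\tau(\mathcal V_R)=\tau(\mathcal V)$ (so $\mathcal V\subset\overline{\mathcal V}_R$). Let $T$ and $T_R$ be the standard Young tableaux associated to $\mathcal V$ and $\mathcal V_R$ respectively. Then there are an integer $i\ge 1$ and a chain $C$ of $T_R$ of length $i$ such that $T$ is obtained from $T_R$ by moving the box containing the maximal element of $C$ from row $i$ to row $i+1$.
   Context: Let $\mathfrak n$ be the strictly upper-triangular $N\times N$ complex matrices, with simple roots $\Pi=\{\alpha_1,\dots,\alpha_{N-1}\}$ and positive roots $R^+=\{\alpha(i,j)=\alpha_i+\cdots+\alpha_j : 1\le i\le j\le N-1\}$. The root vector $X_{\alpha(i,j)}$ spans the matrix position $(i,j+1)$. For $\omega\subseteq\Pi$, $R^+(\omega)$ is the set of positive roots that are sums of elements of $\omega$. Orbital varieties: for a partition $\lambda$ of $N$, $\mathcal O_\lambda$ is the set of nilpotent matrices with Jordan blocks of sizes $\lambda_1,\lambda_2,\dots$. An orbital variety is an irreducible component of $\mathcal O_\lambda\cap\mathfrak n$ for some $\lambda$. Orbital varieties contained in $\mathcal O_\lambda$ are in bijection with standard Young tableaux of shape $\lambda$ (via the Robinson-Schensted correspondence). The tableau $T$ associated to $\mathcal V$ is the one in which, for each $k$, the boxes with entries $\le k$ form the Young diagram of the Jordan type of the upper-left $k\times k$ submatrix of a generic $x\in\mathcal V$. $\tau$-invariant: $\tau(\mathcal V)\subseteq\Pi$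 is the set of simple roots $\alpha$ such that the subgroup generated by the root subgroups of $\pm\alpha$ stabilizes $\mathcal V$ under conjugation. Equivalently, $\alpha_i\in\tau(\mathcal V)$ iff $i$ lies in a strictly higher row than $i+1$ in $T$. For $\tau\subseteq\Pi$ let $\mathfrak m_\tau=\bigoplus_{\alpha\in R^+\setminus R^+(\tau)}\mathbb C X_\alpha$, the nilradical of the standard parabolic subalgebra $\mathfrak p_\tau$ attached to $\tau$. The Richardson orbital variety with $\tau$-invariant $\tau$ is the unique orbital variety $\mathcal V_R$ with $\tau(\mathcal V_R)=\tau$ and $\overline{\mathcal V}_R=\mathfrak m_\tau$. A hypersurface orbital variety is an orbital variety $\mathcal V$ whose closure is a hypersurface (codimension one) in $\mathfrak m_{\tau(\mathcal V)}$. Chains of $T_R$: the orbits on $\{1,\dots,N\}$ of the group generated by the transpositions $(i\ i+1)$, $\alpha_i\in\tau(\mathcal V_R)$. They are intervals of consecutive integers. The length $|C|$ of a chain is its cardinality. The $r$-th smallest element of a chain lies in row $r$ of $T_R$. Moving a box: every other entry stays in its row, and each row is left-justified and written in increasing order. *)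

theory Defs
  imports
    "HOL-Analysis.Abstract_Topology"
    "HOL-Library.Extended_Nat"
    "HOL-Algebra.Sym_Groups"
    "Jordan_Normal_Form.Jordan_Normal_Form"
begin

section \<open>Zariski topology\<close>

inductive_set polyfun :: "nat \<Rightarrow> (complex mat \<Rightarrow> complex) set" for N where
  const: "(\<lambda>_. c) \<in> polyfun N"
| entry: "i < N \<Longrightarrow> j < N \<Longrightarrow> (\<lambda>A. A $$ (i, j)) \<in> polyfun N"
| add: "f \<in> polyfun N \<Longrightarrow> g \<in> polyfun N \<Longrightarrow> (\<lambda>A. f A + g A) \<in> polyfun N"
| mult: "f \<in> polyfun N \<Longrightarrow> g \<in> polyfun N \<Longrightarrow> (\<lambda>A. f A * g A) \<in> polyfun N"

definition zero_locus :: "nat \<Rightarrow> (complex mat \<Rightarrow> complex) set \<Rightarrow> complex mat set" where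
  "zero_locus N F = {A \<in> carrier_mat N N. \<forall>f\<in>F. f A = 0}"

definition zariski :: "nat \<Rightarrow> complex mat topology" where
  "zariski N = topology (\<lambda>U. U \<subseteq> carrier_mat N N \<and>
     (\<exists>F \<subseteq> polyfun N. carrier_mat N N - U = zero_locus N F))"

lemma zero_locus_Un_mult:
  "zero_locus N F \<union> zero_locus N G = zero_locus N {\<lambda>A. f A * g A |f g. f \<in> F \<and> g \<in> G}"
proof
  show "zero_locus N F \<union> zero_locus N G \<subseteq> zero_locus N {\<lambda>A. f A * g A |f g. f \<in> F \<and> g \<in> G}"
    by (auto simp: zero_locus_def)
next
  show "zero_locus N {\<lambda>A. f A * g A |f g. f \<in> F \<and> g \<in> G} \<subseteq> zero_locus N F \<union> zero_locus N G"
  proof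
    fix A
    assume A: "A \<in> zero_locus N {\<lambda>A. f A * g A |f g. f \<in> F \<and> g \<in> G}"
    have "f A * g A = 0" if "f \<in> F" "g \<in> G" for f g
    proof -
      have "(\<lambda>A. f A * g A) \<in> {\<lambda>A. f A * g A |f g. f \<in> F \<and> g \<in> G}"
        using that by blast
      then show ?thesis using A unfolding zero_locus_def by fastforce
    qed
    then have "(\<forall>f\<in>F. f A = 0) \<or> (\<forall>g\<in>G. g A = 0)"
      by (meson mult_eq_0_iff)
    then show "A \<in> zero_locus N F \<union> zero_locus N G"
      using A by (auto simp: zero_locus_def)
  qed
qed

lemma openin_zariski:
  "openin (zariski N) U \<longleftrightarrow> U \<subseteq> carrier_mat N N \<and>
     (\<exists>F \<subseteq> polyfun N. carrier_mat N N - U = zero_locus N F)"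
proof -
  let ?M = "carrier_mat N N :: complex mat set"
  let ?L = "\<lambda>U. U \<subseteq> ?M \<and> (\<exists>F \<subseteq> polyfun N. ?M - U = zero_locus N F)"
  have "?L (S \<inter> T)" if S: "?L S" and T: "?L T" for S T
  proof -
    from S T obtain F G where FG: "F \<subseteq> polyfun N" "G \<subseteq> polyfun N"
      "?M - S = zero_locus N F" "?M - T = zero_locus N G" by blast
    have "?M - S \<inter> T = zero_locus N {\<lambda>A. f A * g A |f g. f \<in> F \<and> g \<in> G}"
      using FG zero_locus_Un_mult[of N F G] by (metis Diff_Int)
    moreover have "{\<lambda>A. f A * g A |f g. f \<in> F \<and> g \<in> G} \<subseteq> polyfun N"
      using FG by (auto intro: polyfun.mult)
    ultimately show ?thesis using S by blast
  qed
  moreover have "?L (\<Union>\<K>)" if "\<forall>K\<in>\<K>. ?L K" for \<K>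
  proof -
    from that obtain F where F: "\<And>K. K \<in> \<K> \<Longrightarrow> F K \<subseteq> polyfun N"
      "\<And>K. K \<in> \<K> \<Longrightarrow> ?M - K = zero_locus N (F K)" by metis
    have "A \<in> ?M - \<Union>\<K> \<longleftrightarrow> A \<in> zero_locus N (\<Union>(F ` \<K>))" for A
    proof -
      have "A \<in> ?M - \<Union>\<K> \<longleftrightarrow> A \<in> ?M \<and> (\<forall>K\<in>\<K>. A \<in> ?M - K)" by blast
      also have "\<dots> \<longleftrightarrow> A \<in> ?M \<and> (\<forall>K\<in>\<K>. A \<in> zero_locus N (F K))" using F(2) by auto
      also have "\<dots> \<longleftrightarrow> A \<in> zero_locus N (\<Union>(F ` \<K>))" by (auto simp: zero_locus_def)
      finally show ?thesis .
    qed
    then have "?M - \<Union>\<K> = zero_locus N (\<Union>(F ` \<K>))" by blast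
    moreover have "\<Union>(F ` \<K>) \<subseteq> polyfun N" using F(1) by blast
    ultimately show ?thesis using that by blast
  qed
  ultimately have "istopology ?L" unfolding istopology_def by blast
  then show ?thesis unfolding zariski_def by simp
qed

definition irreducible_space :: "'a topology \<Rightarrow> bool" where
  "irreducible_space X \<longleftrightarrow> topspace X \<noteq> {} \<and>
     (\<forall>A B. closedin X A \<longrightarrow> closedin X B \<longrightarrow> A \<union> B = topspace X \<longrightarrow>
        A = topspace X \<or> B = topspace X)"

definition irreducible_in :: "'a topology \<Rightarrow> 'a set \<Rightarrow> bool" where
  "irreducible_in X S \<longleftrightarrow> S \<subseteq> topspace X \<and> irreducible_space (subtopology X S)"

definition irreducible_component :: "'a topology \<Rightarrow> 'a set \<Rightarrow> bool" where
  "irreducible_component X S \<longleftrightarrow>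
     irreducible_in X S \<and> (\<forall>S'. irreducible_in X S' \<longrightarrow> S \<subseteq> S' \<longrightarrow> S' = S)"

text \<open>Combinatorial codimension of an irreducible closed subset.\<close>

definition codim :: "'a topology \<Rightarrow> 'a set \<Rightarrow> enat" where
  "codim X Z = Sup {enat n |n. \<exists>c. c 0 = Z \<and>
     (\<forall>i\<le>n. closedin X (c i) \<and> irreducible_in X (c i)) \<and> (\<forall>i<n. c i \<subset> c (Suc i))}"

definition hypersurface_in :: "'a topology \<Rightarrow> 'a set \<Rightarrow> bool" where
  "hypersurface_in X Z \<longleftrightarrow> closedin X Z \<and> irreducible_in X Z \<and> codim X Z = 1"

text \<open>A nonempty open subset of an irreducible \<open>V\<close> is dense in it.\<close>

definition generically :: "'a topology \<Rightarrow> 'a set \<Rightarrow> ('a \<Rightarrow> bool) \<Rightarrow> bool" where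
  "generically X V P \<longleftrightarrow> (\<exists>U. openin X U \<and> U \<inter> V \<noteq> {} \<and> (\<forall>x \<in> U \<inter> V. P x))"

section \<open>Orbital varieties\<close>

definition is_partition :: "nat \<Rightarrow> nat list \<Rightarrow> bool" where
  "is_partition N \<mu> \<longleftrightarrow> sorted_wrt (\<ge>) \<mu> \<and> 0 \<notin> set \<mu> \<and> sum_list \<mu> = N"

definition nilpotent_orbit :: "nat \<Rightarrow> nat list \<Rightarrow> complex mat set" where
  "nilpotent_orbit N \<mu> = {A \<in> carrier_mat N N. jordan_nf A (map (\<lambda>k. (k, 0)) \<mu>)}"

definition strictly_upper :: "nat \<Rightarrow> complex mat set" where
  "strictly_upper N = {A \<in> carrier_mat N N. \<forall>p<N. \<forall>q<N. q \<le> p \<longrightarrow> A $$ (p, q) = 0}"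

definition orbital_variety :: "nat \<Rightarrow> complex mat set \<Rightarrow> bool" where
  "orbital_variety N V \<longleftrightarrow> (\<exists>\<mu>. is_partition N \<mu> \<and>
     irreducible_component
       (subtopology (zariski N) (nilpotent_orbit N \<mu> \<inter> strictly_upper N)) V)"

text \<open>
  Simple roots are indexed by \<open>{1..<N}\<close>, but matrix rows and columns start at 0.
  Hence the root vector of the \<open>i\<close>-th simple root sits at position \<open>(i - 1, i)\<close>, and
  \<open>addrow_mat N t (i - 1) i\<close> is the identity plus \<open>t\<close> times this root vector.
\<close>

definition GL :: "nat \<Rightarrow> complex mat monoid" where
  "GL N = units_of (ring_mat TYPE(complex) N ())"

definition simple_root_subgroup :: "nat \<Rightarrow> nat \<Rightarrow> complex mat set" where
  "simple_root_subgroup N i = generate (GL N)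
     (range (\<lambda>t. addrow_mat N t (i - 1) i) \<union> range (\<lambda>t. addrow_mat N t i (i - 1)))"

definition tau_invariant :: "nat \<Rightarrow> complex mat set \<Rightarrow> nat set" where
  "tau_invariant N V = {i \<in> {1..<N}. \<forall>g \<in> simple_root_subgroup N i.
     (\<lambda>x. g * x * inv\<^bsub>GL N\<^esub> g) ` V = V}"

text \<open>
  A sum of simple roots is represented by the multiset of its summands; this is faithful
  because the simple roots are linearly independent.
\<close>

definition pos_root :: "nat \<Rightarrow> nat \<Rightarrow> nat multiset" where
  "pos_root i j = (\<Sum>k = i..j. {#k#})"

definition pos_roots :: "nat \<Rightarrow> nat multiset set" where
  "pos_roots N = {pos_root i j |i j. 1 \<le> i \<and> i \<le> j \<and> j < N}"

definition pos_roots_sub :: "nat \<Rightarrow> nat set \<Rightarrow> nat multiset set" where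
  "pos_roots_sub N \<omega> = {\<beta> \<in> pos_roots N. set_mset \<beta> \<subseteq> \<omega>}"

text \<open>
  The root vector of \<open>pos_root i j\<close> sits at the 0-based position \<open>(i - 1, j)\<close>, so
  position \<open>(p, q)\<close> belongs to \<open>pos_root (p + 1) q\<close>, which is not a root unless \<open>p < q\<close>.
\<close>

definition nilradical :: "nat \<Rightarrow> nat set \<Rightarrow> complex mat set" where
  "nilradical N \<tau> = {A \<in> carrier_mat N N. \<forall>p<N. \<forall>q<N.
     A $$ (p, q) \<noteq> 0 \<longrightarrow> pos_root (p + 1) q \<in> pos_roots N - pos_roots_sub N \<tau>}"

definition richardson_orbital_variety :: "nat \<Rightarrow> nat set \<Rightarrow> complex mat set \<Rightarrow> bool" where
  "richardson_orbital_variety N \<tau> V \<longleftrightarrow>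
     orbital_variety N V \<and> tau_invariant N V = \<tau> \<and> zariski N closure_of V = nilradical N \<tau>"

definition hypersurface_orbital_variety :: "nat \<Rightarrow> complex mat set \<Rightarrow> bool" where
  "hypersurface_orbital_variety N V \<longleftrightarrow> orbital_variety N V \<and>
     hypersurface_in (subtopology (zariski N) (nilradical N (tau_invariant N V)))
       (zariski N closure_of V)"

section \<open>Tableaux\<close>

text \<open>A tableau is the list of its rows, from top to bottom.\<close>

definition standard_tableau :: "nat \<Rightarrow> nat list list \<Rightarrow> bool" where
  "standard_tableau N T \<longleftrightarrow>
     [] \<notin> set T \<and> sorted_wrt (\<ge>) (map length T) \<and>
     (\<forall>r \<in> set T. sorted_wrt (<) r) \<and>
     (\<forall>i j. Suc i < length T \<longrightarrow> j < length (T ! Suc i) \<longrightarrow> T ! i ! j < T ! Suc i ! j) \<and>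
     distinct (concat T) \<and> set (concat T) = {1..N}"

text \<open>Row lengths of the part of the tableau with entries at most \<open>k\<close>.\<close>

definition shape_upto :: "nat \<Rightarrow> nat list list \<Rightarrow> nat list" where
  "shape_upto k T = filter (\<lambda>l. l \<noteq> 0) (map (\<lambda>r. length (filter (\<lambda>x. x \<le> k) r)) T)"

definition upper_left :: "nat \<Rightarrow> complex mat \<Rightarrow> complex mat" where
  "upper_left k A = mat k k (\<lambda>(p, q). A $$ (p, q))"

definition associated_tableau :: "nat \<Rightarrow> complex mat set \<Rightarrow> nat list list \<Rightarrow> bool" where
  "associated_tableau N V T \<longleftrightarrow> standard_tableau N T \<and>
     (\<forall>k \<in> {1..N}. generically (zariski N) V
        (\<lambda>x. upper_left k x \<in> nilpotent_orbit k (shape_upto k T)))"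

definition tau_chains :: "nat \<Rightarrow> nat set \<Rightarrow> nat set set" where
  "tau_chains N \<tau> = {(\<lambda>g. g x) ` generate (sym_group N) {Transposition.transpose i (i + 1) |i. i \<in> \<tau>} |x.
     x \<in> {1..N}}"

text \<open>
  Move the entry \<open>m\<close> from row \<open>i\<close> to row \<open>i + 1\<close>, rows being counted from 1; row \<open>i + 1\<close> is
  created if the tableau has only \<open>i\<close> rows.
\<close>

definition move_box :: "nat \<Rightarrow> nat \<Rightarrow> nat list list \<Rightarrow> nat list list" where
  "move_box m i T = (let T' = (if i < length T then T else T @ [[]])
     in T'[i - 1 := remove1 m (T' ! (i - 1)), i := insort m (T' ! i)])"

end

theory Submission
  imports Defs "HOL-Library.Function_Algebras"
begin

text \<open>
  Adding column \<open>k\<close> to the upper left \<open>(k - 1) \<times> (k - 1)\<close> block \<open>A\<close> of a strictly upper triangular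
  matrix adds a box in column \<open>c\<close> of the Jordan type iff the new column \<open>v\<close> satisfies
  \<open>A\<^sup>c\<^sup>-\<^sup>1 v \<in> im A\<^sup>c\<close> with \<open>c\<close> minimal; this condition has codimension the number of rows above the box.
  Invariance under the root subgroup of \<open>\<alpha>\<^sub>i\<close> makes the rows strictly increase along the chains, so
  the row of an entry is at least its position in its chain, and an excess is an extra
  condition on the corresponding column. On the Richardson variety, which is dense in the nilradical,
  there is no excess. For a hypersurface \<open>V\<close>, the cylinder over \<open>V\<close> in a direction that violates one of
  these conditions is irreducible, hence dense in the nilradical by maximality of the closure of \<open>V\<close>.
  A second condition, on another column or on the same one, would survive on the cylinder; so exactly
  one entry is one row too low, and by strictness it is the last of its chain. Without any excess,
  \<open>V\<close> and the Richardson variety would be the same component of the same orbit.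
\<close>

section \<open>Irreducible sets\<close>

text \<open>Jordan types enter through ranks of powers: if the block of size k has the Jordan type
  prescribed by the tableau, its c-th power has as rank the number of boxes with entry at most k in
  columns after c. An upper bound on such a rank is a Zariski closed condition, so what holds at
  generic points of \<open>V\<close> passes to all of \<open>V\<close>, to its closure, and to the
  conjugates that \<tau>-invariance provides. Codimension one is used through strict chains: the
  closure of \<open>V\<close> is not the whole nilradical, and no irreducible closed set fits
  strictly in between. The delicate point is which conditions survive on a cylinder. A direction
  that changes column k leaves all earlier columns alone, so of two excessive entries the later one
  has to supply the direction and the earlier one the surviving condition. Within a single column a
  condition survives only after the moving direction has been divided out. Irreducibility and
  closedness of the nilradical are inherited from the Richardson variety, whose closure it
  is.\<close>

lemma irreducible_in_iff:
  "irreducible_in X S \<longleftrightarrow> S \<subseteq> topspace X \<and> S \<noteq> {} \<and>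
     (\<forall>A B. closedin X A \<longrightarrow> closedin X B \<longrightarrow> S \<subseteq> A \<union> B \<longrightarrow> S \<subseteq> A \<or> S \<subseteq> B)"
proof (cases "S \<subseteq> topspace X")
  case True
  then have ts: "topspace (subtopology X S) = S" by (simp add: inf.absorb2)
  show ?thesis
  proof
    assume L: "irreducible_in X S"
    have "S \<subseteq> A \<or> S \<subseteq> B" if "closedin X A" "closedin X B" "S \<subseteq> A \<union> B" for A B
    proof -
      have "closedin (subtopology X S) (A \<inter> S)" "closedin (subtopology X S) (B \<inter> S)"
        using that unfolding closedin_subtopology by blast+
      moreover have "(A \<inter> S) \<union> (B \<inter> S) = S" using that by blast
      ultimately have "A \<inter> S = S \<or> B \<inter> S = S"
        using L ts unfolding irreducible_in_def irreducible_space_def by simp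
      then show ?thesis by blast
    qed
    then show "S \<subseteq> topspace X \<and> S \<noteq> {} \<and>
     (\<forall>A B. closedin X A \<longrightarrow> closedin X B \<longrightarrow> S \<subseteq> A \<union> B \<longrightarrow> S \<subseteq> A \<or> S \<subseteq> B)"
      using L ts True unfolding irreducible_in_def irreducible_space_def by simp
  next
    assume R: "S \<subseteq> topspace X \<and> S \<noteq> {} \<and>
     (\<forall>A B. closedin X A \<longrightarrow> closedin X B \<longrightarrow> S \<subseteq> A \<union> B \<longrightarrow> S \<subseteq> A \<or> S \<subseteq> B)"
    have "A = S \<or> B = S" if AB: "closedin (subtopology X S) A" "closedin (subtopology X S) B" "A \<union> B = S" for A B
    proof -
      from AB obtain A' B' where "closedin X A'" "A = A' \<inter> S" "closedin X B'" "B = B' \<inter> S"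
        unfolding closedin_subtopology by blast
      moreover from this have "S \<subseteq> A' \<or> S \<subseteq> B'" using R AB(3) by blast
      ultimately show ?thesis by blast
    qed
    then show "irreducible_in X S"
      unfolding irreducible_in_def irreducible_space_def ts using R by blast
  qed
qed (auto simp: irreducible_in_def)

lemma irreducible_in_subtopology:
  "irreducible_in (subtopology X U) S \<longleftrightarrow> S \<subseteq> U \<and> irreducible_in X S"
  unfolding irreducible_in_def by (auto simp: subtopology_subtopology Int_absorb1)

text \<open>A closed set that contains \<open>S\<close> contains its closure, hence
  \<open>S'\<close>. Intermediate \<open>S'\<close> are needed for the trace of a closure on an
  orbit.\<close>

lemma irreducible_in_between_closure:
  assumes "irreducible_in X S" "S \<subseteq> S'" "S' \<subseteq> X closure_of S"
  shows "irreducible_in X S'"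
  unfolding irreducible_in_iff
proof (intro conjI allI impI)
  show "S' \<subseteq> topspace X" using assms(3) closure_of_subset_topspace[of X S] by (rule subset_trans)
  show "S' \<noteq> {}" using assms(1,2) unfolding irreducible_in_iff by blast
  fix A B
  assume AB: "closedin X A" "closedin X B" "S' \<subseteq> A \<union> B"
  then have "S \<subseteq> A \<or> S \<subseteq> B" using assms(1,2) unfolding irreducible_in_iff by blast
  then have "X closure_of S \<subseteq> A \<or> X closure_of S \<subseteq> B"
    using AB(1,2) closure_of_minimal by metis
  then show "S' \<subseteq> A \<or> S' \<subseteq> B" using assms(3) by blast
qed

lemma generically_conj:
  assumes V: "irreducible_in X V" and "generically X V P" "generically X V Q"
  shows "generically X V (\<lambda>x. P x \<and> Q x)"
proof -
  from assms obtain U U' where U: "openin X U" "U \<inter> V \<noteq> {}" "\<forall>x\<in>U \<inter> V. P x"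
    "openin X U'" "U' \<inter> V \<noteq> {}" "\<forall>x\<in>U' \<inter> V. Q x"
    unfolding generically_def by blast
  have VX: "V \<subseteq> topspace X" using V unfolding irreducible_in_iff by blast
  have "U \<inter> U' \<inter> V \<noteq> {}"
  proof
    assume "U \<inter> U' \<inter> V = {}"
    then have "V \<subseteq> (topspace X - U) \<union> (topspace X - U')" using VX by blast
    then have "V \<subseteq> topspace X - U \<or> V \<subseteq> topspace X - U'"
      using V U(1,4) unfolding irreducible_in_iff by blast
    then show False using U(2,5) by blast
  qed
  then show ?thesis using U unfolding generically_def
    by (intro exI[of _ "U \<inter> U'"]) auto
qed

lemma generically_Ball:
  assumes V: "irreducible_in X V" and "finite K" "\<And>k. k \<in> K \<Longrightarrow> generically X V (P k)"
  shows "generically X V (\<lambda>x. \<forall>k\<in>K. P k x)"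
  using assms(2,3)
proof (induction K)
  case empty
  have "V \<inter> topspace X \<noteq> {}" using V unfolding irreducible_in_iff by blast
  then show ?case unfolding generically_def by (intro exI[of _ "topspace X"]) auto
next
  case (insert k K)
  then have "generically X V (\<lambda>x. P k x \<and> (\<forall>k\<in>K. P k x))"
    using generically_conj[OF V] by simp
  then show ?case by simp
qed

lemma generically_ex: "generically X V P \<Longrightarrow> \<exists>x\<in>V. P x"
  unfolding generically_def by blast

text \<open>\<open>V\<close> is covered by \<open>F\<close> and the complement of the open set on
  which \<open>P\<close> holds, and irreducibility selects \<open>F\<close>. This turns generic
  ranks into bounds valid on all of \<open>V\<close>.\<close>

lemma generically_closedin_subset:
  assumes V: "irreducible_in X V" and "generically X V P"
    and F: "closedin X F" "\<And>x. x \<in> V \<Longrightarrow> P x \<Longrightarrow> x \<in> F"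
  shows "V \<subseteq> F"
proof -
  from assms obtain U where U: "openin X U" "U \<inter> V \<noteq> {}" "\<forall>x\<in>U \<inter> V. P x"
    unfolding generically_def by blast
  have VX: "V \<subseteq> topspace X" using V unfolding irreducible_in_iff by blast
  have "V \<subseteq> F \<union> (topspace X - U)" using U F VX by blast
  then have "V \<subseteq> F \<or> V \<subseteq> topspace X - U"
    using V U(1) F(1) unfolding irreducible_in_iff by blast
  then show ?thesis using U(2) by blast
qed

text \<open>If \<open>W\<close> were proper, then \<open>Z\<close>, \<open>W\<close> and the whole
  space would form a strict chain of length two.\<close>

lemma hypersurface_in_maximal:
  assumes "hypersurface_in X Z" "closedin X W" "irreducible_in X W" "Z \<subset> W"
    and "irreducible_in X (topspace X)"
  shows "W = topspace X"
proof (rule ccontr)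
  assume ne: "W \<noteq> topspace X"
  then have W: "W \<subset> topspace X" using closedin_subset[OF assms(2)] by blast
  define c where "c = (\<lambda>i::nat. if i = 0 then Z else if i = 1 then W else topspace X)"
  have "c 0 = Z \<and> (\<forall>i\<le>2. closedin X (c i) \<and> irreducible_in X (c i)) \<and> (\<forall>i<2. c i \<subset> c (Suc i))"
    using assms W unfolding c_def hypersurface_in_def by (auto simp: less_Suc_eq numeral_2_eq_2)
  then have "enat 2 \<le> codim X Z" unfolding codim_def by (intro Sup_upper) blast
  then show False using assms(1) unfolding hypersurface_in_def
    by (simp add: one_enat_def)
qed

lemma hypersurface_in_neq_topspace:
  assumes "hypersurface_in X Z"
  shows "Z \<noteq> topspace X"
proof
  assume Z: "Z = topspace X"
  have "codim X Z \<le> 0" unfolding codim_def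
  proof (rule Sup_least)
    fix m
    assume "m \<in> {enat n |n. \<exists>c. c 0 = Z \<and>
     (\<forall>i\<le>n. closedin X (c i) \<and> irreducible_in X (c i)) \<and> (\<forall>i<n. c i \<subset> c (Suc i))}"
    then obtain n c where c: "m = enat n" "c 0 = Z" "\<forall>i\<le>n. closedin X (c i)" "\<forall>i<n. c i \<subset> c (Suc i)"
      by blast
    have "n = 0"
    proof (rule ccontr)
      assume "n \<noteq> 0"
      then have "Z \<subset> c 1" "closedin X (c 1)" using c by auto
      then show False using Z closedin_subset by blast
    qed
    then show "m \<le> 0" using c(1) by (simp add: zero_enat_def)
  qed
  then show False using assms unfolding hypersurface_in_def by simp
qed

section \<open>Zariski topology\<close>

lemma topspace_zariski: "topspace (zariski N) = carrier_mat N N"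
proof
  show "topspace (zariski N) \<subseteq> carrier_mat N N"
    using openin_topspace[of "zariski N"] unfolding openin_zariski by blast
  have "carrier_mat N N - carrier_mat N N = zero_locus N {\<lambda>_. 1}" by (auto simp: zero_locus_def)
  then have "openin (zariski N) (carrier_mat N N)" unfolding openin_zariski
    using polyfun.const[of 1 N] by blast
  then show "carrier_mat N N \<subseteq> topspace (zariski N)" by (rule openin_subset)
qed

lemma closedin_zariski: "closedin (zariski N) S \<longleftrightarrow> (\<exists>F \<subseteq> polyfun N. S = zero_locus N F)"
proof -
  have "zero_locus N F \<subseteq> carrier_mat N N" for F by (auto simp: zero_locus_def)
  then show ?thesis
    unfolding closedin_def topspace_zariski openin_zariski
    by (metis Diff_subset double_diff subset_refl)
qed

lemma polyfun_sum:
  "finite I \<Longrightarrow> (\<And>i. i \<in> I \<Longrightarrow> f i \<in> polyfun N) \<Longrightarrow> (\<lambda>A. \<Sum>i\<in>I. f i A) \<in> polyfun N"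
  by (induction I rule: finite_induct) (simp_all add: polyfun.const polyfun.add)

lemma polyfun_prod:
  "finite I \<Longrightarrow> (\<And>i. i \<in> I \<Longrightarrow> f i \<in> polyfun N) \<Longrightarrow> (\<lambda>A. \<Prod>i\<in>I. f i A) \<in> polyfun N"
  by (induction I rule: finite_induct) (simp_all add: polyfun.const polyfun.mult)

lemma polyfun_det:
  assumes "\<And>a b. a < m \<Longrightarrow> b < m \<Longrightarrow> (\<lambda>x. M x a b) \<in> polyfun N"
  shows "(\<lambda>x. det (mat m m (\<lambda>(a, b). M x a b))) \<in> polyfun N"
proof -
  have eq: "det (mat m m (\<lambda>(a, b). M x a b)) =
     (\<Sum>p | p permutes {0..<m}. signof p * (\<Prod>i = 0..<m. M x i (p i)))" for x
  proof -
    have "det (mat m m (\<lambda>(a, b). M x a b)) =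
     (\<Sum>p | p permutes {0..<m}. signof p * (\<Prod>i = 0..<m. mat m m (\<lambda>(a, b). M x a b) $$ (i, p i)))"
      by (rule det_def') simp
    also have "\<dots> = (\<Sum>p | p permutes {0..<m}. signof p * (\<Prod>i = 0..<m. M x i (p i)))"
      by (intro sum.cong refl arg_cong2[of _ _ _ _ "(*)"] prod.cong) (auto dest: permutes_in_image)
    finally show ?thesis .
  qed
  show ?thesis unfolding eq
    by (intro polyfun_sum polyfun.mult polyfun.const polyfun_prod assms)
       (auto simp: finite_permutations dest: permutes_in_image)
qed

lemma polyfun_translate:
  assumes "f \<in> polyfun N" "D \<in> carrier_mat N N"
  shows "(\<lambda>x. f (x + D)) \<in> polyfun N"
  using assms(1)
proof induction
  case (entry i j)
  then have "(\<lambda>x. (x + D) $$ (i, j)) = (\<lambda>x. x $$ (i, j) + D $$ (i, j))"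
    using assms(2) by auto
  then show ?case using entry by (simp add: polyfun.const polyfun.add polyfun.entry)
qed (simp_all add: polyfun.const polyfun.add polyfun.mult)

lemma polyfun_line:
  assumes "f \<in> polyfun N" "x \<in> carrier_mat N N" "D \<in> carrier_mat N N"
  shows "\<exists>p. \<forall>t. f (x + t \<cdot>\<^sub>m D) = poly p t"
  using assms(1)
proof induction
  case (const c)
  then show ?case by (intro exI[of _ "[:c:]"]) simp
next
  case (entry i j)
  then show ?case using assms(2,3)
    by (intro exI[of _ "[:x $$ (i, j), D $$ (i, j):]"]) (auto simp: mult.commute)
next
  case (add f g)
  then obtain p q where "\<forall>t. f (x + t \<cdot>\<^sub>m D) = poly p t" "\<forall>t. g (x + t \<cdot>\<^sub>m D) = poly q t" by blast
  then show ?case by (intro exI[of _ "p + q"]) simp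
next
  case (mult f g)
  then obtain p q where "\<forall>t. f (x + t \<cdot>\<^sub>m D) = poly p t" "\<forall>t. g (x + t \<cdot>\<^sub>m D) = poly q t" by blast
  then show ?case by (intro exI[of _ "p * q"]) simp
qed

text \<open>On the line, equations \<open>f\<close> of \<open>A\<close> and \<open>g\<close> of
  \<open>B\<close> become polynomials in the parameter. If neither vanishes identically, some
  parameter avoids the finitely many roots of their product, and that point lies outside both
  sets.\<close>

lemma line_subset_closed_Un:
  assumes "closedin (zariski N) A" "closedin (zariski N) B"
    and x: "x \<in> carrier_mat N N" and D: "D \<in> carrier_mat N N"
    and sub: "range (\<lambda>t. x + t \<cdot>\<^sub>m D) \<subseteq> A \<union> B"
  shows "range (\<lambda>t. x + t \<cdot>\<^sub>m D) \<subseteq> A \<or> range (\<lambda>t. x + t \<cdot>\<^sub>m D) \<subseteq> B"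
proof (rule ccontr)
  assume neg: "\<not> ?thesis"
  from assms(1,2) obtain F G where FG: "F \<subseteq> polyfun N" "A = zero_locus N F"
    "G \<subseteq> polyfun N" "B = zero_locus N G" unfolding closedin_zariski by blast
  have car: "x + t \<cdot>\<^sub>m D \<in> carrier_mat N N" for t using x D by simp
  from neg obtain s t f g where fg: "f \<in> F" "f (x + s \<cdot>\<^sub>m D) \<noteq> 0" "g \<in> G" "g (x + t \<cdot>\<^sub>m D) \<noteq> 0"
    using FG car unfolding zero_locus_def by blast
  obtain p q where p: "\<And>t. f (x + t \<cdot>\<^sub>m D) = poly p t" and q: "\<And>t. g (x + t \<cdot>\<^sub>m D) = poly q t"
    using polyfun_line[OF _ x D] fg FG by (meson subsetD)
  have "p * q \<noteq> 0" using fg p q by auto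
  then have "finite {u. poly (p * q) u = 0}" by (rule poly_roots_finite)
  then obtain u where u: "poly (p * q) u \<noteq> 0"
    using infinite_UNIV_char_0 by (metis (mono_tags, lifting) UNIV_eq_I mem_Collect_eq)
  have "x + u \<cdot>\<^sub>m D \<in> A \<union> B" using sub by blast
  then show False using u fg FG p q unfolding zero_locus_def by auto
qed

text \<open>For closed \<open>C\<close>, the points whose whole line lies in \<open>C\<close> form a
  closed set, cut out by all translates of the equations of \<open>C\<close>. Each line over
  \<open>Z\<close> lies in \<open>A\<close> or in \<open>B\<close>, so a covering of the cylinder
  induces one of \<open>Z\<close> by two closed sets.\<close>

lemma irreducible_in_cylinder:
  assumes Z: "irreducible_in (zariski N) Z" and D: "D \<in> carrier_mat N N"
  shows "irreducible_in (zariski N) {z + t \<cdot>\<^sub>m D |z t. z \<in> Z}" (is "irreducible_in _ ?W")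
  unfolding irreducible_in_iff
proof (intro conjI allI impI)
  have Zc: "Z \<subseteq> carrier_mat N N" using Z unfolding irreducible_in_iff topspace_zariski by blast
  show "?W \<subseteq> topspace (zariski N)" unfolding topspace_zariski using Zc D by auto
  show "?W \<noteq> {}" using Z unfolding irreducible_in_iff by blast
  fix A B
  assume AB: "closedin (zariski N) A" "closedin (zariski N) B" "?W \<subseteq> A \<union> B"
  have cl: "closedin (zariski N) {z \<in> carrier_mat N N. \<forall>t. z + t \<cdot>\<^sub>m D \<in> C}"
    if C: "closedin (zariski N) C" for C
  proof -
    from C obtain F where F: "F \<subseteq> polyfun N" "C = zero_locus N F" unfolding closedin_zariski by blast
    have "{z \<in> carrier_mat N N. \<forall>t. z + t \<cdot>\<^sub>m D \<in> C} =
      zero_locus N {\<lambda>z. f (z + t \<cdot>\<^sub>m D) |f t. f \<in> F}"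
      using F D unfolding zero_locus_def by (auto 0 4)
    moreover have "{\<lambda>z. f (z + t \<cdot>\<^sub>m D) |f t. f \<in> F} \<subseteq> polyfun N"
      using F(1) D polyfun_translate[of _ N] by fastforce
    ultimately show ?thesis unfolding closedin_zariski by blast
  qed
  let ?A = "{z \<in> carrier_mat N N. \<forall>t. z + t \<cdot>\<^sub>m D \<in> A}" and ?B = "{z \<in> carrier_mat N N. \<forall>t. z + t \<cdot>\<^sub>m D \<in> B}"
  have "Z \<subseteq> ?A \<union> ?B"
  proof
    fix z assume z: "z \<in> Z"
    then have "range (\<lambda>t. z + t \<cdot>\<^sub>m D) \<subseteq> A \<union> B" using AB(3) by blast
    from line_subset_closed_Un[OF AB(1,2) _ D this] z Zc
    show "z \<in> ?A \<union> ?B" by blast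
  qed
  then have "Z \<subseteq> ?A \<or> Z \<subseteq> ?B" using Z cl[OF AB(1)] cl[OF AB(2)] unfolding irreducible_in_iff by blast
  then show "?W \<subseteq> A \<or> ?W \<subseteq> B" by blast
qed

section \<open>Linear algebra in the space of sequences\<close>

text \<open>Vectors of every length are padded by zeros and live in one space of sequences, so
  columns of blocks of different sizes can be compared directly. This space has infinite dimension,
  whence the finiteness hypotheses in the dimension lemmas.\<close>

definition scale_fun :: "complex \<Rightarrow> (nat \<Rightarrow> complex) \<Rightarrow> nat \<Rightarrow> complex" where
  "scale_fun c f = (\<lambda>i. c * f i)"

interpretation fs: vector_space scale_fun
  by unfold_locales (auto simp: scale_fun_def fun_eq_iff algebra_simps)

interpretation fs_pair: vector_space_pair scale_fun scale_fun
  by unfold_locales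

interpretation fs_dual: vector_space_pair scale_fun "(*) :: complex \<Rightarrow> complex \<Rightarrow> complex"
  by unfold_locales (auto simp: algebra_simps)

context vector_space
begin

lemma dim_mono_finite:
  assumes "finite T" "S \<subseteq> span T"
  shows "dim S \<le> dim T"
proof -
  obtain B where B: "B \<subseteq> T" "independent B" "T \<subseteq> span B" "card B = dim T" by (rule basis_exists)
  have "S \<subseteq> span B" using assms(2) B(3) span_mono span_span by (metis subset_trans)
  then show ?thesis using dim_le_card B assms(1) by (metis finite_subset)
qed

lemma dim_insert_finite:
  assumes "finite S"
  shows "dim (insert v S) = (if v \<in> span S then dim S else Suc (dim S))"
proof (cases "v \<in> span S")
  case True
  then show ?thesis using span_eq_dim[OF span_redundant] by simp
next
  case False
  obtain B where B: "B \<subseteq> S" "independent B" "S \<subseteq> span B" "card B = dim S" by (rule basis_exists)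
  have fB: "finite B" using B(1) assms finite_subset by blast
  have vB: "v \<notin> span B" using False span_mono[OF B(1)] by blast
  have "dim (insert v S) = card (insert v B)"
  proof (rule basis_card_eq_dim[symmetric])
    show "insert v B \<subseteq> insert v S" using B by blast
    show "insert v S \<subseteq> span (insert v B)"
      using B(3) span_mono[of B "insert v B"] span_base[of v "insert v B"] by blast
    show "independent (insert v B)" using independent_insertI[OF vB B(2)] .
  qed
  also have "\<dots> = Suc (card B)" using fB vB span_base by (subst card_insert_disjoint) auto
  finally show ?thesis using B(4) False by simp
qed

lemma dim_Un_le_card:
  assumes "finite S" "finite T"
  shows "dim (S \<union> T) \<le> dim S + card T"
  using assms(2)
proof (induction T)
  case (insert t T)
  then have "dim (insert t (S \<union> T)) \<le> Suc (dim (S \<union> T))"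
    using assms(1) by (subst dim_insert_finite) auto
  then show ?case using insert by simp
qed simp

text \<open>A family may repeat a vector, and then its range has too few elements for the dimension
  count; a repetition gives the coefficients 1 and -1 at once.\<close>

lemma scalars_dependent_family:
  assumes "finite T" "u ` {..s} \<subseteq> span T" "card T \<le> s"
  shows "\<exists>c. (\<exists>b\<le>s. c b \<noteq> 0) \<and> (\<Sum>b\<le>s. scale (c b) (u b)) = 0"
proof (cases "inj_on u {..s}")
  case False
  then obtain a b where ab: "a \<le> s" "b \<le> s" "a \<noteq> b" "u a = u b" unfolding inj_on_def by auto
  let ?c = "\<lambda>i. if i = a then 1 else if i = b then - 1 else 0"
  have "(\<Sum>i\<le>s. scale (?c i) (u i)) = (\<Sum>i\<in>{a, b}. scale (?c i) (u i))"
    using ab by (intro sum.mono_neutral_right) auto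
  also have "\<dots> = 0" using ab by simp
  finally show ?thesis using ab by (intro exI[of _ ?c]) (auto intro: exI[of _ a])
next
  case True
  then have "card (u ` {..s}) = Suc s" by (simp add: card_image)
  then have "dependent (u ` {..s})"
    using independent_span_bound[OF assms(1) _ assms(2)] assms(3) by linarith
  then obtain c where c: "\<exists>v\<in>u ` {..s}. c v \<noteq> 0" "(\<Sum>v\<in>u ` {..s}. scale (c v) v) = 0"
    by (subst (asm) dependent_finite) auto
  then show ?thesis using sum.reindex[OF True, of "\<lambda>v. scale (c v) v"]
    by (intro exI[of _ "c \<circ> u"]) auto
qed

end

definition unit_fun :: "nat \<Rightarrow> nat \<Rightarrow> complex" where
  "unit_fun p = (\<lambda>i. if i = p then 1 else 0)"

lemma inj_unit_fun: "inj_on unit_fun I"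
proof (rule inj_onI)
  fix p q assume "unit_fun p = unit_fun q"
  from fun_cong[OF this, of p] show "p = q" by (simp add: unit_fun_def split: if_splits)
qed

lemma sum_fun_apply: "(\<Sum>i\<in>I. f i) x = (\<Sum>i\<in>I. f i x)" for f :: "'a \<Rightarrow> 'b \<Rightarrow> complex"
  by (induction I rule: infinite_finite_induct) auto

lemma expand_unit_fun:
  assumes "\<And>i. n \<le> i \<Longrightarrow> f i = 0"
  shows "f = (\<Sum>p<n. scale_fun (f p) (unit_fun p))"
proof
  fix i
  have "(\<Sum>p<n. scale_fun (f p) (unit_fun p)) i = (\<Sum>p<n. if p = i then f p else 0)"
    unfolding sum_fun_apply by (intro sum.cong) (auto simp: scale_fun_def unit_fun_def)
  then show "f i = (\<Sum>p<n. scale_fun (f p) (unit_fun p)) i" using assms[of i] by simp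
qed

lemma independent_unit_fun:
  assumes "finite I"
  shows "fs.independent (unit_fun ` I)"
proof (rule fs.independent_if_scalars_zero)
  fix f x
  assume s: "(\<Sum>x\<in>unit_fun ` I. scale_fun (f x) x) = 0" and "x \<in> unit_fun ` I"
  then obtain i where i: "i \<in> I" "x = unit_fun i" by blast
  have "(\<Sum>i\<in>I. scale_fun (f (unit_fun i)) (unit_fun i)) = 0"
    using s by (simp add: sum.reindex[OF inj_unit_fun])
  then have "(\<Sum>j\<in>I. scale_fun (f (unit_fun j)) (unit_fun j)) i = 0" by simp
  moreover have "(\<Sum>j\<in>I. scale_fun (f (unit_fun j)) (unit_fun j)) i =
      (\<Sum>j\<in>I. if j = i then f (unit_fun j) else 0)"
    unfolding sum_fun_apply by (intro sum.cong) (auto simp: scale_fun_def unit_fun_def)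
  ultimately have "(\<Sum>j\<in>I. if j = i then f (unit_fun j) else 0) = 0" by simp
  then show "f x = 0" using i assms by simp
qed (use assms in simp)

lemma card_unit_fun: "card (unit_fun ` I) = card I"
  by (rule card_image[OF inj_unit_fun])

text \<open>Instead of minors of order \<open>s + 1\<close>, the equations are det (P G) = 0, where
  G consists of \<open>s + 1\<close> chosen columns and P is any scalar matrix. Dependent columns
  give a kernel vector of G, hence of P G. For independent columns some P makes the product the
  identity.\<close>

lemma closedin_dim_le:
  fixes g :: "nat \<Rightarrow> complex mat \<Rightarrow> nat \<Rightarrow> complex" and m n s :: nat
  assumes poly: "\<And>j i. j < m \<Longrightarrow> i < n \<Longrightarrow> (\<lambda>x. g j x i) \<in> polyfun N"
    and supp: "\<And>j i x. j < m \<Longrightarrow> n \<le> i \<Longrightarrow> g j x i = 0"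
  shows "closedin (zariski N) {x \<in> carrier_mat N N. fs.dim ((\<lambda>j. g j x) ` {..<m}) \<le> s}"
proof -
  have ball_F: "(\<forall>f\<in>{D P J |P J. Q J}. f x = 0) \<longleftrightarrow> (\<forall>P J. Q J \<longrightarrow> D P J x = 0)"
    for D :: "(nat \<Rightarrow> nat \<Rightarrow> complex) \<Rightarrow> (nat \<Rightarrow> nat) \<Rightarrow> complex mat \<Rightarrow> complex" and Q x
    by blast
  let ?D = "\<lambda>P J x. det (mat (Suc s) (Suc s) (\<lambda>(a, b). \<Sum>i<n. P a i * g (J b) x i))"
  let ?F = "{?D P J |P J. \<forall>b\<le>s. J b < m}"
  have "?D P J \<in> polyfun N" if "\<forall>b\<le>s. J b < m" for P J
    by (rule polyfun_det, rule polyfun_sum, simp, rule polyfun.mult[OF polyfun.const], rule poly)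
       (use that in auto)
  then have "?F \<subseteq> polyfun N" by blast
  moreover have "fs.dim ((\<lambda>j. g j x) ` {..<m}) \<le> s \<longleftrightarrow>
      (\<forall>P J. (\<forall>b\<le>s. J b < m) \<longrightarrow> ?D P J x = 0)" for x
  proof
    assume d: "fs.dim ((\<lambda>j. g j x) ` {..<m}) \<le> s"
    obtain B where B: "B \<subseteq> (\<lambda>j. g j x) ` {..<m}" "(\<lambda>j. g j x) ` {..<m} \<subseteq> fs.span B"
      "card B = fs.dim ((\<lambda>j. g j x) ` {..<m})" by (rule fs.basis_exists)
    have "?D P J x = 0" if J: "\<forall>b\<le>s. J b < m" for P J
    proof -
      have sub: "(\<lambda>b. g (J b) x) ` {..s} \<subseteq> fs.span B" using B(2) J by auto
      have finB: "finite B" using finite_subset[OF B(1)] by simp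
      have "card B \<le> s" using B(3) d by simp
      from fs.scalars_dependent_family[OF finB sub this]
      obtain c where c: "\<exists>b\<le>s. c b \<noteq> 0" "(\<Sum>b\<le>s. scale_fun (c b) (g (J b) x)) = 0"
        by blast
      have ci: "(\<Sum>b\<le>s. c b * g (J b) x i) = 0" for i
        using fun_cong[OF c(2), of i] unfolding sum_fun_apply by (simp add: scale_fun_def)
      let ?M = "mat (Suc s) (Suc s) (\<lambda>(a, b). \<Sum>i<n. P a i * g (J b) x i)"
      have "?M *\<^sub>v vec (Suc s) c = 0\<^sub>v (Suc s)"
      proof (rule eq_vecI)
        fix a assume "a < dim_vec (0\<^sub>v (Suc s))"
        then have a: "a < Suc s" by simp
        have "(?M *\<^sub>v vec (Suc s) c) $ a = (\<Sum>b<Suc s. (\<Sum>i<n. P a i * g (J b) x i) * c b)"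
          using a by (simp add: scalar_prod_def atLeast0LessThan)
        also have "\<dots> = (\<Sum>b<Suc s. \<Sum>i<n. P a i * (c b * g (J b) x i))"
          unfolding sum_distrib_right by (intro sum.cong refl) simp
        also have "\<dots> = (\<Sum>i<n. \<Sum>b<Suc s. P a i * (c b * g (J b) x i))"
          by (rule sum.swap)
        also have "\<dots> = (\<Sum>i<n. P a i * (\<Sum>b\<le>s. c b * g (J b) x i))"
          by (simp only: sum_distrib_left lessThan_Suc_atMost)
        also have "\<dots> = 0" using ci by simp
        finally show "(?M *\<^sub>v vec (Suc s) c) $ a = 0\<^sub>v (Suc s) $ a" using a by simp
      qed simp
      moreover have "vec (Suc s) c \<noteq> 0\<^sub>v (Suc s)"
        using c(1) by (auto simp: vec_eq_iff less_Suc_eq_le)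
      ultimately show ?thesis
        by (subst det_0_iff_vec_prod_zero_field[of _ "Suc s"], simp)
           (intro exI[of _ "vec (Suc s) c"] conjI, simp_all)
    qed
    then show "\<forall>P J. (\<forall>b\<le>s. J b < m) \<longrightarrow> ?D P J x = 0" by simp
  next
    assume F: "\<forall>P J. (\<forall>b\<le>s. J b < m) \<longrightarrow> ?D P J x = 0"
    show "fs.dim ((\<lambda>j. g j x) ` {..<m}) \<le> s"
    proof (rule ccontr)
      assume d: "\<not> ?thesis"
      obtain B where B: "B \<subseteq> (\<lambda>j. g j x) ` {..<m}" "fs.independent B"
        "card B = fs.dim ((\<lambda>j. g j x) ` {..<m})" by (rule fs.basis_exists)
      then obtain B' where B': "B' \<subseteq> B" "card B' = Suc s" "finite B'"
        using d obtain_subset_with_card_n[of "Suc s" B] by auto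
      then obtain u where u: "bij_betw u {..s} B'"
        by (metis card_atMost finite_atMost finite_same_card_bij)
      have "\<forall>b\<le>s. \<exists>j<m. u b = g j x" using u B' B(1) unfolding bij_betw_def by blast
      then obtain J where J: "\<forall>b\<le>s. J b < m \<and> u b = g (J b) x" by metis
      have ind: "fs.independent B'" using fs.independent_mono[OF B(2) B'(1)] .
      have "\<forall>a. \<exists>h. Vector_Spaces.linear scale_fun (*) h \<and> (\<forall>v\<in>B'. h v = (if v = u a then 1 else 0))"
        by (rule allI, rule fs_dual.linear_independent_extend[OF ind])
      then obtain \<phi> where lin: "\<And>a. Vector_Spaces.linear scale_fun (*) (\<phi> a)"
        and \<phi>: "\<And>a v. v \<in> B' \<Longrightarrow> \<phi> a v = (if v = u a then 1 else 0)" by metis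
      \<comment> \<open>Row \<open>a\<close> of the scalar matrix holds the coordinates of the
        functional dual to the \<open>a\<close>-th independent column.\<close>
      let ?P = "\<lambda>a i. \<phi> a (unit_fun i)"
      have "(\<Sum>i<n. ?P a i * g (J b) x i) = (if a = b then 1 else 0)" if ab: "a \<le> s" "b \<le> s" for a b
      proof -
        have "g (J b) x = (\<Sum>i<n. scale_fun (g (J b) x i) (unit_fun i))"
          using expand_unit_fun supp J ab by blast
        then have "\<phi> a (g (J b) x) = (\<Sum>i<n. g (J b) x i * ?P a i)"
          using fs_dual.linear_sum[OF lin] fs_dual.linear_scale[OF lin] by (metis (no_types, lifting) sum.cong)
        moreover have "g (J b) x \<in> B'" using J ab u unfolding bij_betw_def by (metis atMost_iff imageI)
        moreover have "g (J b) x = u a \<longleftrightarrow> a = b"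
          using J ab u unfolding bij_betw_def inj_on_def by (metis atMost_iff)
        ultimately show ?thesis using \<phi> by (simp add: mult.commute)
      qed
      then have "mat (Suc s) (Suc s) (\<lambda>(a, b). \<Sum>i<n. ?P a i * g (J b) x i) = 1\<^sub>m (Suc s)"
        by (intro eq_matI) auto
      then have "?D ?P J x = 1" by simp
      moreover have "?D ?P J x = 0" using F J by simp
      ultimately show False by simp
    qed
  qed
  then have "{x \<in> carrier_mat N N. fs.dim ((\<lambda>j. g j x) ` {..<m}) \<le> s} = zero_locus N ?F"
    unfolding zero_locus_def ball_F by blast
  ultimately show ?thesis unfolding closedin_zariski by blast
qed

section \<open>Ranks of powers of nilpotent matrices\<close>

definition mat_act :: "complex mat \<Rightarrow> (nat \<Rightarrow> complex) \<Rightarrow> nat \<Rightarrow> complex" where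
  "mat_act A f = (\<lambda>i. if i < dim_row A then \<Sum>p<dim_col A. A $$ (i, p) * f p else 0)"

lemma linear_mat_act: "Vector_Spaces.linear scale_fun scale_fun (mat_act A)"
proof -
  have "mat_act A (f + g) = mat_act A f + mat_act A g" for f g
    by (rule ext) (simp add: mat_act_def distrib_left sum.distrib)
  moreover have "mat_act A (scale_fun c f) = scale_fun c (mat_act A f)" for c f
    by (rule ext) (simp add: mat_act_def scale_fun_def sum_distrib_right mult.commute[of c])
  ultimately show ?thesis
    unfolding Vector_Spaces.linear_iff using fs.vector_space_axioms by blast
qed

lemma linear_funpow:
  assumes "Vector_Spaces.linear scale_fun scale_fun h"
  shows "Vector_Spaces.linear scale_fun scale_fun (h ^^ c)"
proof (induction c)
  case 0
  show ?case by unfold_locales (auto simp: scale_fun_def fun_eq_iff algebra_simps)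
next
  case (Suc c)
  then show ?case using Vector_Spaces.linear_compose[OF Suc assms] by (simp only: funpow.simps)
qed

lemma mat_act_mult:
  assumes "A \<in> carrier_mat m n" "B \<in> carrier_mat n l"
  shows "mat_act (A * B) f = mat_act A (mat_act B f)"
proof
  fix i
  show "mat_act (A * B) f i = mat_act A (mat_act B f) i"
  proof (cases "i < m")
    case True
    have "mat_act (A * B) f i = (\<Sum>p<l. (\<Sum>q<n. A $$ (i, q) * B $$ (q, p)) * f p)"
      using True assms unfolding mat_act_def
      by (auto intro!: sum.cong simp: scalar_prod_def atLeast0LessThan)
    also have "\<dots> = (\<Sum>p<l. \<Sum>q<n. A $$ (i, q) * (B $$ (q, p) * f p))"
      unfolding sum_distrib_right by (intro sum.cong refl) simp
    also have "\<dots> = (\<Sum>q<n. \<Sum>p<l. A $$ (i, q) * (B $$ (q, p) * f p))" by (rule sum.swap)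
    also have "\<dots> = (\<Sum>q<n. A $$ (i, q) * (\<Sum>p<l. B $$ (q, p) * f p))"
      by (simp only: sum_distrib_left)
    finally show ?thesis using True assms unfolding mat_act_def by (auto intro!: sum.cong)
  qed (use assms in \<open>auto simp: mat_act_def\<close>)
qed

lemma mat_act_one: "(\<And>i. n \<le> i \<Longrightarrow> f i = 0) \<Longrightarrow> mat_act (1\<^sub>m n) f = f"
  unfolding mat_act_def
  by (rule ext) (auto simp: if_distrib[of "\<lambda>x. x * _"] intro!: sum.cong cong: if_cong)

definition mat_cols :: "complex mat \<Rightarrow> (nat \<Rightarrow> complex) set" where
  "mat_cols A = (\<lambda>p. mat_act A (unit_fun p)) ` {..<dim_col A}"

definition mat_rank :: "complex mat \<Rightarrow> nat" where
  "mat_rank A = fs.dim (mat_cols A)"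

lemma finite_mat_cols: "finite (mat_cols A)"
  unfolding mat_cols_def by simp

lemma mat_act_unit_fun:
  "p < dim_col A \<Longrightarrow> mat_act A (unit_fun p) = (\<lambda>i. if i < dim_row A then A $$ (i, p) else 0)"
  unfolding mat_act_def unit_fun_def
  by (rule ext) (auto simp: if_distrib[of "(*) _"] cong: if_cong)

lemma mat_act_in_span: "mat_act A f \<in> fs.span (mat_cols A)"
proof -
  have "mat_act A f = mat_act A (\<lambda>p. if p < dim_col A then f p else 0)"
    unfolding mat_act_def by (rule ext) (auto intro!: sum.cong)
  also have "(\<lambda>p. if p < dim_col A then f p else 0) = (\<Sum>p<dim_col A. scale_fun (f p) (unit_fun p))"
    by (subst expand_unit_fun[of "dim_col A"]) (auto intro!: sum.cong)
  also have "mat_act A \<dots> = (\<Sum>p<dim_col A. scale_fun (f p) (mat_act A (unit_fun p)))"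
    by (simp add: fs_pair.linear_sum[OF linear_mat_act] fs_pair.linear_scale[OF linear_mat_act])
  also have "\<dots> \<in> fs.span (mat_cols A)"
    by (intro fs.span_sum fs.span_scale fs.span_base) (auto simp: mat_cols_def)
  finally show ?thesis .
qed

text \<open>\<open>P\<close> maps a basis of the column space of \<open>M\<close> onto a spanning
  set for the columns of the product. Applied in both directions, this makes the rank a similarity
  invariant.\<close>

lemma mat_rank_mult_le:
  assumes P: "P \<in> carrier_mat m n" and M: "M \<in> carrier_mat n l" and Q: "Q \<in> carrier_mat l r"
  shows "mat_rank (P * M * Q) \<le> mat_rank M"
proof -
  obtain B where B: "B \<subseteq> mat_cols M" "fs.independent B" "mat_cols M \<subseteq> fs.span B" "card B = mat_rank M"
    unfolding mat_rank_def by (rule fs.basis_exists)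
  have fB: "finite B" using finite_subset[OF B(1) finite_mat_cols] .
  have PM: "P * M \<in> carrier_mat m l" using P M by simp
  have "mat_act M f \<in> fs.span B" for f
    using mat_act_in_span fs.span_mono[OF B(3)] fs.span_span by blast
  then have "mat_act P (mat_act M f) \<in> fs.span (mat_act P ` B)" for f
    unfolding fs_pair.linear_span_image[OF linear_mat_act] by blast
  then have "mat_cols (P * M * Q) \<subseteq> fs.span (mat_act P ` B)"
    unfolding mat_cols_def mat_act_mult[OF PM Q] mat_act_mult[OF P M] by blast
  then have "mat_rank (P * M * Q) \<le> card (mat_act P ` B)"
    unfolding mat_rank_def using fB by (intro fs.dim_le_card) auto
  also have "\<dots> \<le> mat_rank M" using card_image_le[OF fB] B(4) by simp
  finally show ?thesis .
qed

lemma mat_rank_similar: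
  assumes "similar_mat_wit A B P Q"
  shows "mat_rank A = mat_rank B"
proof -
  note w = similar_mat_witD[OF refl assms]
  have "B = Q * A * P" using similar_mat_wit_sym[OF assms] unfolding similar_mat_wit_def Let_def by simp
  then show ?thesis using mat_rank_mult_le[OF w(6,5,7)] mat_rank_mult_le[OF w(7,4,6)] w(3) by simp
qed

text \<open>The nonzero columns are exactly the unit vectors indexed by \<open>I\<close>. Two
  inclusions are used because a zero column may or may not occur.\<close>

definition unit_cols :: "complex mat \<Rightarrow> nat set \<Rightarrow> bool" where
  "unit_cols M I \<longleftrightarrow> finite I \<and> mat_cols M \<subseteq> insert 0 (unit_fun ` I) \<and> unit_fun ` I \<subseteq> mat_cols M"

lemma mat_rank_unit_cols:
  assumes "unit_cols M I"
  shows "mat_rank M = card I"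
  unfolding mat_rank_def card_unit_fun[of I, symmetric]
proof (rule fs.basis_card_eq_dim[symmetric])
  show "unit_fun ` I \<subseteq> mat_cols M" using assms unfolding unit_cols_def by blast
  have "insert 0 (unit_fun ` I) \<subseteq> fs.span (unit_fun ` I)"
    using fs.span_superset fs.span_zero by blast
  then show "mat_cols M \<subseteq> fs.span (unit_fun ` I)" using assms unfolding unit_cols_def by blast
  show "fs.independent (unit_fun ` I)" using assms unfolding unit_cols_def
    by (intro independent_unit_fun) blast
qed

text \<open>The power shifts the unit vector at \<open>p\<close> to \<open>p - c\<close> and kills
  those with \<open>p < c\<close>; truncated subtraction covers \<open>c > l\<close>.\<close>

lemma unit_cols_jordan_block_pow: "unit_cols (jordan_block l 0 ^\<^sub>m c) {..<l - c}"
proof -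
  let ?M = "jordan_block l (0 :: complex) ^\<^sub>m c"
  have col: "mat_act ?M (unit_fun p) = (if c \<le> p then unit_fun (p - c) else 0)" if "p < l" for p
    using that by (subst mat_act_unit_fun)
      (auto simp: jordan_block_zero_pow unit_fun_def fun_eq_iff)
  have "mat_cols ?M \<subseteq> insert 0 (unit_fun ` {..<l - c})"
    unfolding mat_cols_def using col by auto
  moreover have "unit_fun p \<in> mat_cols ?M" if "p < l - c" for p
    unfolding mat_cols_def using col[of "p + c"] that
    by (intro image_eqI[of _ _ "p + c"]) auto
  ultimately show ?thesis unfolding unit_cols_def by auto
qed

lemma unit_cols_four_block:
  assumes A: "unit_cols A I" "A \<in> carrier_mat n n" "I \<subseteq> {..<n}"
    and B: "unit_cols B J" "B \<in> carrier_mat m m"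
  shows "unit_cols (four_block_mat A (0\<^sub>m n m) (0\<^sub>m m n) B) (I \<union> (\<lambda>i. n + i) ` J)" (is "unit_cols ?M _")
proof -
  have dim: "dim_row ?M = n + m" "dim_col ?M = n + m" using A B by auto
  have colA: "mat_act ?M (unit_fun p) = mat_act A (unit_fun p)" if "p < n" for p
    using that A B by (subst (1 2) mat_act_unit_fun) (auto simp: fun_eq_iff)
  have colB: "mat_act ?M (unit_fun (n + p)) = (\<lambda>i. if i < n then 0 else mat_act B (unit_fun p) (i - n))"
    if "p < m" for p
    using that A B by (subst (1 2) mat_act_unit_fun) (auto simp: fun_eq_iff)
  have sh: "(\<lambda>i. if i < n then 0 else unit_fun p (i - n)) = unit_fun (n + p)" for p
    by (auto simp: unit_fun_def fun_eq_iff)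
  have sh0: "(\<lambda>i. if i < n then 0 else (0::nat\<Rightarrow>complex) (i - n)) = 0"
    by (auto simp: fun_eq_iff)
  have split: "{..<n + m} = {..<n} \<union> (\<lambda>p. n + p) ` {..<m}"
  proof
    show "{..<n + m} \<subseteq> {..<n} \<union> (\<lambda>p. n + p) ` {..<m}"
    proof
      fix x assume "x \<in> {..<n + m}"
      then show "x \<in> {..<n} \<union> (\<lambda>p. n + p) ` {..<m}"
        by (cases "x < n") (auto intro: image_eqI[of _ _ "x - n"])
    qed
  qed auto
  have cols: "mat_cols ?M = mat_cols A \<union> (\<lambda>f i. if i < n then 0 else f (i - n)) ` mat_cols B"
    unfolding mat_cols_def dim split image_Un image_image using A(2) B(2) colA colB
    by (intro arg_cong2[of _ _ _ _ "(\<union>)"] image_cong) auto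
  have "mat_cols ?M \<subseteq> insert 0 (unit_fun ` (I \<union> (\<lambda>i. n + i) ` J))"
  proof -
    have "mat_cols A \<subseteq> insert 0 (unit_fun ` I)" using A(1) unfolding unit_cols_def by blast
    moreover have "(\<lambda>f i. if i < n then 0 else f (i - n)) ` mat_cols B
      \<subseteq> (\<lambda>f i. if i < n then 0 else f (i - n)) ` insert 0 (unit_fun ` J)"
      using B(1) unfolding unit_cols_def by (intro image_mono) blast
    moreover have "\<dots> = insert 0 (unit_fun ` (\<lambda>i. n + i) ` J)"
      unfolding image_insert image_image sh sh0 ..
    ultimately show ?thesis unfolding cols by blast
  qed
  moreover have "unit_fun ` (I \<union> (\<lambda>i. n + i) ` J) \<subseteq> mat_cols ?M"
  proof -
    have "(\<lambda>f i. if i < n then 0 else f (i - n)) ` unit_fun ` J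
      \<subseteq> (\<lambda>f i. if i < n then 0 else f (i - n)) ` mat_cols B"
      using B(1) unfolding unit_cols_def by (intro image_mono) blast
    then have "unit_fun ` (\<lambda>i. n + i) ` J \<subseteq> (\<lambda>f i. if i < n then 0 else f (i - n)) ` mat_cols B"
      unfolding image_image sh .
    then show ?thesis using A(1) unfolding cols unit_cols_def by blast
  qed
  ultimately show ?thesis using A(1) B(1) unfolding unit_cols_def by blast
qed

lemma unit_cols_jordan_matrix_pow:
  "\<exists>I. I \<subseteq> {..<sum_list \<mu>} \<and> card I = (\<Sum>l\<leftarrow>\<mu>. l - c) \<and>
    unit_cols (jordan_matrix (map (\<lambda>l. (l, 0)) \<mu>) ^\<^sub>m c) I"
proof (induction \<mu>)
  case Nil
  show ?case by (intro exI[of _ "{}"]) (auto simp: jordan_matrix_pow unit_cols_def mat_cols_def)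
next
  case (Cons l \<mu>)
  then obtain I where I: "I \<subseteq> {..<sum_list \<mu>}" "card I = (\<Sum>l\<leftarrow>\<mu>. l - c)"
    "unit_cols (jordan_matrix (map (\<lambda>l. (l, 0)) \<mu>) ^\<^sub>m c) I" by blast
  let ?B = "jordan_matrix (map (\<lambda>l. (l, 0)) \<mu>) ^\<^sub>m c :: complex mat"
  have B: "?B \<in> carrier_mat (sum_list \<mu>) (sum_list \<mu>)"
    using pow_carrier_mat[OF jordan_matrix_carrier[of "map (\<lambda>l. (l, 0 :: complex)) \<mu>"]]
    by (simp add: comp_def)
  have eq: "jordan_matrix (map (\<lambda>l. (l, 0)) (l # \<mu>)) ^\<^sub>m c =
    four_block_mat (jordan_block l 0 ^\<^sub>m c) (0\<^sub>m l (sum_list \<mu>)) (0\<^sub>m (sum_list \<mu>) l) ?B"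
    using B by (simp add: jordan_matrix_pow Let_def)
  have "unit_cols (jordan_matrix (map (\<lambda>l. (l, 0)) (l # \<mu>)) ^\<^sub>m c) ({..<l - c} \<union> (\<lambda>i. l + i) ` I)"
    unfolding eq by (rule unit_cols_four_block[OF unit_cols_jordan_block_pow _ _ I(3) B]) auto
  moreover have "card ({..<l - c} \<union> (\<lambda>i. l + i) ` I) = (l - c) + card I"
    using finite_subset[OF I(1)] by (subst card_Un_disjoint) (auto simp: card_image)
  ultimately show ?case using I(1,2)
    by (intro exI[of _ "{..<l - c} \<union> (\<lambda>i. l + i) ` I"]) auto
qed

text \<open>Similarity reduces this to the Jordan matrix, where a block of size \<open>l\<close>
  contributes \<open>l - c\<close>, which is 0 once \<open>c\<close> reaches \<open>l\<close>. The
  sum counts the boxes after column \<open>c\<close> in the diagram with rows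
  \<open>\<mu>\<close>.\<close>

lemma mat_rank_pow_nilpotent_orbit:
  assumes "A \<in> nilpotent_orbit k \<mu>"
  shows "mat_rank (A ^\<^sub>m c) = (\<Sum>l\<leftarrow>\<mu>. l - c)"
proof -
  from assms obtain P Q where "similar_mat_wit A (jordan_matrix (map (\<lambda>k. (k, 0)) \<mu>)) P Q"
    unfolding nilpotent_orbit_def jordan_nf_def similar_mat_def by blast
  from mat_rank_similar[OF similar_mat_wit_pow[OF this]]
  have "mat_rank (A ^\<^sub>m c) = mat_rank (jordan_matrix (map (\<lambda>k. (k, 0)) \<mu>) ^\<^sub>m c)" .
  then show ?thesis using unit_cols_jordan_matrix_pow[of \<mu> c] mat_rank_unit_cols by metis
qed

section \<open>Growth of the upper left blocks by one column\<close>

lemma upper_left_carrier [simp]: "upper_left k x \<in> carrier_mat k k"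
  unfolding upper_left_def by simp

lemma upper_left_index [simp]: "i < k \<Longrightarrow> j < k \<Longrightarrow> upper_left k x $$ (i, j) = x $$ (i, j)"
  unfolding upper_left_def by simp

lemma upper_left_dim [simp]: "dim_row (upper_left k x) = k" "dim_col (upper_left k x) = k"
  unfolding upper_left_def by simp_all

definition upper_left_act :: "nat \<Rightarrow> complex mat \<Rightarrow> (nat \<Rightarrow> complex) \<Rightarrow> nat \<Rightarrow> complex" where
  "upper_left_act k x = mat_act (upper_left k x)"

lemma upper_left_act_apply:
  "upper_left_act k x f i = (if i < k then \<Sum>p<k. x $$ (i, p) * f p else 0)"
  unfolding upper_left_act_def mat_act_def by simp

lemma linear_upper_left_act_pow:
  "Vector_Spaces.linear scale_fun scale_fun (upper_left_act k x ^^ c)"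
  unfolding upper_left_act_def by (rule linear_funpow[OF linear_mat_act])

lemma upper_left_act_pow_support:
  assumes "\<And>i. k \<le> i \<Longrightarrow> f i = 0" "k \<le> i"
  shows "(upper_left_act k x ^^ c) f i = 0"
  using assms by (cases c) (auto simp: upper_left_act_apply)

text \<open>Iterating the action, rather than forming matrix powers, makes both the passage from
  \<open>k\<close> to \<open>Suc k\<close> and the polynomial dependence on \<open>x\<close> simple
  inductions.\<close>

definition pow_cols :: "nat \<Rightarrow> nat \<Rightarrow> complex mat \<Rightarrow> (nat \<Rightarrow> complex) set" where
  "pow_cols k c x = (\<lambda>p. (upper_left_act k x ^^ c) (unit_fun p)) ` {..<k}"

definition pow_rank :: "nat \<Rightarrow> nat \<Rightarrow> complex mat \<Rightarrow> nat" where
  "pow_rank k c x = fs.dim (pow_cols k c x)"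

lemma finite_pow_cols [simp]: "finite (pow_cols k c x)"
  unfolding pow_cols_def by simp

lemma mat_act_pow:
  assumes A: "A \<in> carrier_mat k k" and f: "\<And>i. k \<le> i \<Longrightarrow> f i = 0"
  shows "mat_act (A ^\<^sub>m c) f = (mat_act A ^^ c) f"
  using f
proof (induction c arbitrary: f)
  case 0
  then show ?case using A mat_act_one[of k f] by simp
next
  case (Suc c)
  have "mat_act A f i = 0" if "k \<le> i" for i using that A by (simp add: mat_act_def)
  then have "mat_act (A ^\<^sub>m c) (mat_act A f) = (mat_act A ^^ c) (mat_act A f)" by (rule Suc.IH)
  then show ?case using mat_act_mult[OF pow_carrier_mat[OF A] A] by (simp add: funpow_swap1)
qed

lemma pow_rank_eq_mat_rank: "pow_rank k c x = mat_rank (upper_left k x ^\<^sub>m c)"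
proof -
  have "dim_col (upper_left k x ^\<^sub>m c) = k"
    using pow_carrier_mat[OF upper_left_carrier[of k x], of c] by blast
  then have "pow_cols k c x = mat_cols (upper_left k x ^\<^sub>m c)"
    unfolding pow_cols_def mat_cols_def upper_left_act_def
    by (intro image_cong) (auto simp: mat_act_pow[OF upper_left_carrier] unit_fun_def)
  then show ?thesis unfolding pow_rank_def mat_rank_def by simp
qed

definition trunc_col :: "nat \<Rightarrow> nat \<Rightarrow> complex mat \<Rightarrow> nat \<Rightarrow> complex" where
  "trunc_col k q x = (\<lambda>i. if i < k then x $$ (i, q) else 0)"

text \<open>In a strictly upper triangular matrix, row \<open>k\<close> vanishes up to the diagonal,
  so the larger block differs only by its new column.\<close>

lemma upper_left_act_Suc:
  assumes x: "x \<in> strictly_upper N" and k: "k < N"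
  shows "upper_left_act (Suc k) x f = upper_left_act k x f + scale_fun (f k) (trunc_col k k x)"
proof
  fix i
  have "x $$ (k, p) = 0" if "p \<le> k" for p using x k that unfolding strictly_upper_def by auto
  then show "upper_left_act (Suc k) x f i = (upper_left_act k x f + scale_fun (f k) (trunc_col k k x)) i"
    by (cases i k rule: linorder_cases)
      (auto simp: upper_left_act_apply trunc_col_def scale_fun_def intro: sum.neutral)
qed

lemma upper_left_act_pow_Suc:
  assumes x: "x \<in> strictly_upper N" and k: "k < N" and f: "f k = 0"
  shows "(upper_left_act (Suc k) x ^^ c) f = (upper_left_act k x ^^ c) f"
proof (induction c)
  case (Suc c)
  have "(upper_left_act k x ^^ c) f k = 0"
    using f by (cases c) (auto simp: upper_left_act_apply)
  then show ?case using Suc upper_left_act_Suc[OF x k, of "(upper_left_act k x ^^ c) f"]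
    by (simp add: scale_fun_def zero_fun_def[symmetric])
qed simp

text \<open>One application of the larger block turns the last unit vector into the new column
  \<open>trunc_col k k x\<close>. That vector has no component at \<open>k\<close>, so from then on
  the smaller block acts. Hence exponent \<open>Suc c\<close> on the left and \<open>c\<close> on
  the new column.\<close>

lemma pow_cols_Suc:
  assumes x: "x \<in> strictly_upper N" and k: "k < N"
  shows "pow_cols (Suc k) (Suc c) x =
    insert ((upper_left_act k x ^^ c) (trunc_col k k x)) (pow_cols k (Suc c) x)"
proof -
  have 1: "(upper_left_act (Suc k) x ^^ Suc c) (unit_fun p) = (upper_left_act k x ^^ Suc c) (unit_fun p)"
    if "p < k" for p
    by (rule upper_left_act_pow_Suc[OF x k]) (use that in \<open>simp add: unit_fun_def\<close>)
  have "upper_left_act k x (unit_fun k) = 0"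
    by (auto simp: upper_left_act_apply unit_fun_def fun_eq_iff intro!: sum.neutral)
  then have "upper_left_act (Suc k) x (unit_fun k) = trunc_col k k x"
    by (simp add: upper_left_act_Suc[OF x k]) (simp add: unit_fun_def scale_fun_def)
  then have "(upper_left_act (Suc k) x ^^ Suc c) (unit_fun k) = (upper_left_act (Suc k) x ^^ c) (trunc_col k k x)"
    by (simp only: funpow_Suc_right o_apply)
  also have "\<dots> = (upper_left_act k x ^^ c) (trunc_col k k x)"
    by (rule upper_left_act_pow_Suc[OF x k]) (simp add: trunc_col_def)
  finally have 2: "(upper_left_act (Suc k) x ^^ Suc c) (unit_fun k) = (upper_left_act k x ^^ c) (trunc_col k k x)" .
  show ?thesis unfolding pow_cols_def lessThan_Suc image_insert 2
    by (intro arg_cong2[of _ _ _ _ insert] image_cong refl 1) simp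
qed

lemma pow_rank_Suc:
  assumes "x \<in> strictly_upper N" "k < N"
  shows "pow_rank (Suc k) (Suc c) x =
    (if (upper_left_act k x ^^ c) (trunc_col k k x) \<in> fs.span (pow_cols k (Suc c) x)
     then pow_rank k (Suc c) x else Suc (pow_rank k (Suc c) x))"
  unfolding pow_rank_def pow_cols_Suc[OF assms] by (rule fs.dim_insert_finite) simp

text \<open>The last \<open>s\<close> unit vectors and \<open>W\<close> account for at most
  \<open>s + card W\<close> dimensions. Read contrapositively, a larger drop of rank yields a unit
  vector below \<open>k - s\<close> whose image is new modulo \<open>W\<close>.\<close>

lemma pow_rank_jump_le:
  assumes "finite W"
    and "\<And>p. p < k - s \<Longrightarrow> (upper_left_act k x ^^ c) (unit_fun p) \<in> fs.span (pow_cols k (Suc c) x \<union> W)"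
  shows "pow_rank k c x \<le> pow_rank k (Suc c) x + card W + s"
proof -
  let ?S = "(\<lambda>p. (upper_left_act k x ^^ c) (unit_fun p)) ` {k - s..<k}"
  have "pow_cols k c x \<subseteq> fs.span ((pow_cols k (Suc c) x \<union> W) \<union> ?S)"
  proof
    fix f assume "f \<in> pow_cols k c x"
    then obtain p where p: "p < k" "f = (upper_left_act k x ^^ c) (unit_fun p)"
      unfolding pow_cols_def by blast
    show "f \<in> fs.span ((pow_cols k (Suc c) x \<union> W) \<union> ?S)"
    proof (cases "p < k - s")
      case True
      then show ?thesis using assms(2) p(2) fs.span_mono[of "pow_cols k (Suc c) x \<union> W"] by blast
    next
      case False
      then have "f \<in> ?S" using p by auto
      then show ?thesis by (intro fs.span_base UnI2)
    qed
  qed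
  then have "pow_rank k c x \<le> fs.dim ((pow_cols k (Suc c) x \<union> W) \<union> ?S)"
    unfolding pow_rank_def using assms(1) by (intro fs.dim_mono_finite) auto
  also have "\<dots> \<le> fs.dim (pow_cols k (Suc c) x \<union> W) + card ?S"
    using assms(1) by (intro fs.dim_Un_le_card) auto
  also have "\<dots> \<le> pow_rank k (Suc c) x + card W + s"
  proof (rule add_mono)
    show "fs.dim (pow_cols k (Suc c) x \<union> W) \<le> pow_rank k (Suc c) x + card W"
      unfolding pow_rank_def using assms(1) by (intro fs.dim_Un_le_card) auto
    have "card ?S \<le> card {k - s..<k}" by (rule card_image_le) simp
    then show "card ?S \<le> s" by simp
  qed
  finally show ?thesis .
qed

lemma polyfun_upper_left_act_pow:
  assumes "\<And>i. (\<lambda>x. f x i) \<in> polyfun N" "k \<le> N"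
  shows "(\<lambda>x. (upper_left_act k x ^^ c) (f x) i) \<in> polyfun N"
proof (induction c arbitrary: i)
  case (Suc c)
  show ?case
  proof (cases "i < k")
    case True
    then have "(\<lambda>x. (upper_left_act k x ^^ Suc c) (f x) i) =
      (\<lambda>x. \<Sum>p<k. x $$ (i, p) * (upper_left_act k x ^^ c) (f x) p)"
      by (simp add: upper_left_act_apply)
    also have "\<dots> \<in> polyfun N"
      by (rule polyfun_sum, simp, rule polyfun.mult[OF polyfun.entry Suc.IH])
         (use True assms(2) in auto)
    finally show ?thesis .
  next
    case False
    then show ?thesis by (simp add: upper_left_act_apply polyfun.const)
  qed
qed (simp add: assms)

lemma closedin_pow_rank_le:
  assumes "k \<le> N"
  shows "closedin (zariski N) {x \<in> carrier_mat N N. pow_rank k c x \<le> s}"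
  unfolding pow_rank_def pow_cols_def
  by (rule closedin_dim_le[where n = k], rule polyfun_upper_left_act_pow[OF polyfun.const assms],
      rule upper_left_act_pow_support) (auto simp: unit_fun_def)

section \<open>Standard tableaux\<close>

definition upto_length :: "nat \<Rightarrow> nat list \<Rightarrow> nat" where
  "upto_length k r = length (filter (\<lambda>x. x \<le> k) r)"

text \<open>Rows are counted from 0 and columns from 1. Likewise \<open>chain_pos\<close> below is the position of an
  entry in its chain, counted from 0.\<close>

definition row_of :: "nat list list \<Rightarrow> nat \<Rightarrow> nat" where
  "row_of T k = (THE i. i < length T \<and> k \<in> set (T ! i))"

definition col_of :: "nat list list \<Rightarrow> nat \<Rightarrow> nat" where
  "col_of T k = upto_length k (T ! row_of T k)"

text \<open>The number of boxes with entry at most \<open>k\<close> in columns after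
  \<open>c\<close>: the generic rank of the c-th power of the block of size \<open>k\<close>. It is
  unrelated to the excess of a row over a chain position.\<close>

definition shape_excess :: "nat list list \<Rightarrow> nat \<Rightarrow> nat \<Rightarrow> nat" where
  "shape_excess T k c = (\<Sum>r\<leftarrow>T. upto_length k r - c)"

lemma sum_list_shape_upto: "(\<Sum>l\<leftarrow>shape_upto k T. l - c) = shape_excess T k c"
  unfolding shape_upto_def shape_excess_def upto_length_def by (induction T) auto

locale std_tableau =
  fixes N :: nat and T :: "nat list list"
  assumes std: "standard_tableau N T"
begin

lemma row_sorted: "i < length T \<Longrightarrow> sorted_wrt (<) (T ! i)"
  using std nth_mem unfolding standard_tableau_def by blast

lemma row_nonempty: "i < length T \<Longrightarrow> T ! i \<noteq> []"
  using std nth_mem unfolding standard_tableau_def by metis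

lemma row_length_mono: "i \<le> j \<Longrightarrow> j < length T \<Longrightarrow> length (T ! j) \<le> length (T ! i)"
  using std sorted_wrt_nth_less[of "(\<ge>)" "map length T" i j]
  unfolding standard_tableau_def by (cases "i = j") auto

lemma rows_disjoint:
  assumes "i < length T" "j < length T" "k \<in> set (T ! i)" "k \<in> set (T ! j)"
  shows "i = j"
proof (rule ccontr)
  assume "i \<noteq> j"
  have d: "distinct (concat T)" using std unfolding standard_tableau_def by blast
  have ri: "row \<noteq> []" if "row \<in> set T" for row
    using that std unfolding standard_tableau_def by metis
  \<comment> \<open>\<open>distinct_concat_iff\<close> speaks about the list without its empty
    members, so the absence of empty rows has to be brought in.\<close>
  have "removeAll [] T = T" by (rule removeAll_id) (use ri in blast)
  then have "distinct T" using d unfolding distinct_concat_iff by simp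
  then have "T ! i \<noteq> T ! j" using assms(1,2) \<open>i \<noteq> j\<close> by (simp add: nth_eq_iff_index_eq)
  then have "set (T ! i) \<inter> set (T ! j) = {}"
    using d assms(1,2) unfolding distinct_concat_iff by simp
  then show False using assms(3,4) by blast
qed

lemma entries: "(\<exists>i<length T. k \<in> set (T ! i)) \<longleftrightarrow> k \<in> {1..N}"
proof -
  have "set (concat T) = {1..N}" using std unfolding standard_tableau_def by blast
  then show ?thesis by (metis in_set_conv_nth set_concat UN_iff)
qed

lemma row_of_eq:
  assumes "i < length T" "k \<in> set (T ! i)"
  shows "row_of T k = i"
  unfolding row_of_def using assms rows_disjoint by (intro the_equality) auto

lemma row_of:
  assumes "k \<in> {1..N}"
  shows "row_of T k < length T" "k \<in> set (T ! row_of T k)"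
  using assms entries[of k] row_of_eq by auto

lemma upto_length_nth:
  assumes "i < length T" "j < length (T ! i)"
  shows "upto_length (T ! i ! j) (T ! i) = Suc j"
proof -
  let ?r = "T ! i"
  note srt = row_sorted[OF assms(1)]
  have "?r ! l \<le> ?r ! j \<longleftrightarrow> l \<le> j" if "l < length ?r" for l
    using that assms(2) sorted_wrt_nth_less[OF srt, of l j] sorted_wrt_nth_less[OF srt, of j l]
    by (cases l j rule: linorder_cases) auto
  then have "{l. l < length ?r \<and> ?r ! l \<le> ?r ! j} = {..j}" using assms(2) by auto
  then show ?thesis unfolding upto_length_def length_filter_conv_card by simp
qed

lemma upto_length_le_iff:
  assumes "i < length T" "j < length (T ! i)"
  shows "j < upto_length k (T ! i) \<longleftrightarrow> T ! i ! j \<le> k"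
proof -
  let ?r = "T ! i"
  note srt = row_sorted[OF assms(1)]
  have mono: "?r ! l \<le> ?r ! m" if "l \<le> m" "m < length ?r" for l m
    using that sorted_wrt_nth_less[OF srt, of l m] by (cases "l = m") auto
  have fin: "finite {l. l < length ?r \<and> ?r ! l \<le> k}" by simp
  show ?thesis
  proof
    assume "T ! i ! j \<le> k"
    then have "{..j} \<subseteq> {l. l < length ?r \<and> ?r ! l \<le> k}"
      using mono[OF _ assms(2)] assms(2) by (auto intro: le_trans)
    from card_mono[OF fin this] show "j < upto_length k ?r"
      unfolding upto_length_def length_filter_conv_card by simp
  next
    assume L: "j < upto_length k ?r"
    show "?r ! j \<le> k"
    proof (rule ccontr)
      assume "\<not> ?r ! j \<le> k"
      then have "l < j" if "l < length ?r" "?r ! l \<le> k" for l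
        using mono[of j l] that by (cases "j \<le> l") auto
      then have "{l. l < length ?r \<and> ?r ! l \<le> k} \<subseteq> {..<j}" by blast
      from card_mono[OF _ this] show False using L
        unfolding upto_length_def length_filter_conv_card by simp
    qed
  qed
qed

lemma col_of:
  assumes "k \<in> {1..N}"
  shows "1 \<le> col_of T k" "col_of T k \<le> length (T ! row_of T k)"
    "T ! row_of T k ! (col_of T k - 1) = k"
proof -
  obtain j where "j < length (T ! row_of T k)" "T ! row_of T k ! j = k"
    using row_of(2)[OF assms] by (auto simp: in_set_conv_nth)
  then show "1 \<le> col_of T k" "col_of T k \<le> length (T ! row_of T k)"
    "T ! row_of T k ! (col_of T k - 1) = k"
    using upto_length_nth[OF row_of(1)[OF assms], of j] unfolding col_of_def by auto
qed

lemma column_mono: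
  assumes "i \<le> i'" "i' < length T" "j < length (T ! i')"
  shows "T ! i ! j \<le> T ! i' ! j"
  using assms
proof (induction i' rule: dec_induct)
  case (step n)
  have "length (T ! Suc n) \<le> length (T ! n)" by (rule row_length_mono) (use step in auto)
  moreover have "T ! n ! j < T ! Suc n ! j" using std step unfolding standard_tableau_def by blast
  ultimately show ?case using step by simp
qed simp

lemma entry_mono:
  assumes "i \<le> i'" "i' < length T" "j \<le> j'" "j' < length (T ! i')"
  shows "T ! i ! j \<le> T ! i' ! j'"
proof -
  have "j' < length (T ! i)" using row_length_mono[OF assms(1,2)] assms(4) by simp
  then have "T ! i ! j \<le> T ! i ! j'"
    using sorted_wrt_nth_less[OF row_sorted[of i], of j j'] assms by (cases "j = j'") auto
  also have "\<dots> \<le> T ! i' ! j'" by (rule column_mono[OF assms(1,2,4)])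
  finally show ?thesis .
qed

text \<open>Otherwise the box of \<open>b\<close> would lie weakly above and to the left of that of
  \<open>a\<close>, which forces \<open>b \<le> a\<close>.\<close>

lemma row_of_less:
  assumes "a \<in> {1..N}" "b \<in> {1..N}" "a < b" "col_of T b \<le> col_of T a"
  shows "row_of T a < row_of T b"
proof (rule ccontr)
  assume "\<not> ?thesis"
  then have "T ! row_of T b ! (col_of T b - 1) \<le> T ! row_of T a ! (col_of T a - 1)"
    using col_of[OF assms(1)] row_of[OF assms(1)] assms(4) by (intro entry_mono) auto
  then show False using col_of(3) assms(1-3) by simp
qed

lemma upto_length_Suc:
  assumes "Suc k \<in> {1..N}" "i < length T"
  shows "upto_length (Suc k) (T ! i) = upto_length k (T ! i) + (if i = row_of T (Suc k) then 1 else 0)"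
proof -
  have d: "distinct (T ! i)" using row_sorted[OF assms(2)] strict_sorted_iff by blast
  have "length (filter (\<lambda>x. x \<le> Suc k) r) = length (filter (\<lambda>x. x \<le> k) r) + (if Suc k \<in> set r then 1 else 0)"
    if "distinct r" for r
    using that by (induction r) (auto simp: le_Suc_eq)
  then have "upto_length (Suc k) (T ! i) = upto_length k (T ! i) + (if Suc k \<in> set (T ! i) then 1 else 0)"
    using d unfolding upto_length_def by blast
  moreover have "Suc k \<in> set (T ! i) \<longleftrightarrow> i = row_of T (Suc k)"
    using row_of[OF assms(1)] row_of_eq[OF assms(2)] by auto
  ultimately show ?thesis by simp
qed

lemma shape_excess_eq: "shape_excess T k c = (\<Sum>i<length T. upto_length k (T ! i) - c)"
  unfolding shape_excess_def by (simp add: sum_list_sum_nth atLeast0LessThan)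

lemma shape_excess_Suc:
  assumes "Suc k \<in> {1..N}"
  shows "shape_excess T (Suc k) c = shape_excess T k c + (if c < col_of T (Suc k) then 1 else 0)"
proof -
  let ?i = "row_of T (Suc k)"
  have i: "?i < length T" using row_of[OF assms] by simp
  have "shape_excess T (Suc k) c =
    (\<Sum>i<length T. (upto_length k (T ! i) - c) + (if i = ?i then (if c < col_of T (Suc k) then 1 else 0) else 0))"
    unfolding shape_excess_eq col_of_def
    using upto_length_Suc[OF assms] i by (intro sum.cong) auto
  also have "\<dots> = shape_excess T k c + (if c < col_of T (Suc k) then 1 else 0)"
    unfolding sum.distrib shape_excess_eq using i by (subst sum.delta) auto
  finally show ?thesis .
qed

text \<open>The difference counts the rows with more than \<open>c\<close> entries at most
  \<open>k\<close>. Since \<open>Suc k\<close> is put into column \<open>c + 1\<close>, these are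
  exactly the rows above it. In terms of ranks, the drop from power \<open>c\<close> to power
  \<open>c + 1\<close> is the codimension of the condition on the new column.\<close>

lemma shape_excess_row:
  assumes "Suc k \<in> {1..N}" "col_of T (Suc k) = Suc c"
  shows "shape_excess T k c = shape_excess T k (Suc c) + row_of T (Suc k)"
proof -
  let ?i = "row_of T (Suc k)"
  note ri = row_of[OF assms(1)] and ci = col_of[OF assms(1)]
  have long: "Suc c \<le> upto_length k (T ! i) \<longleftrightarrow> i < ?i" if i: "i < length T" for i
  proof (cases i ?i rule: linorder_cases)
    case less
    have "c < length (T ! i)" using row_length_mono[of i ?i] less ri(1) ci(2) assms(2) by simp
    moreover have "T ! i ! c \<le> Suc k"
      using column_mono[of i ?i c] less ri(1) ci(2,3) assms(2) by simp
    moreover have "T ! i ! c \<noteq> Suc k"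
      using row_of_eq[OF i, of "Suc k"] less calculation(1) by (metis nth_mem order_less_irrefl)
    ultimately show ?thesis using upto_length_le_iff[OF i, of c k] less by simp
  next
    case equal
    then show ?thesis using upto_length_Suc[OF assms(1) i] assms(2) unfolding col_of_def by simp
  next
    case greater
    have "\<not> c < upto_length k (T ! i)"
    proof
      assume c: "c < upto_length k (T ! i)"
      then have len: "c < length (T ! i)" unfolding upto_length_def
        by (rule less_le_trans) (rule length_filter_le)
      then have "T ! ?i ! c \<le> T ! i ! c" using column_mono[of ?i i c] greater i by simp
      then show False using c upto_length_le_iff[OF i len] ci(3) assms(2) by simp
    qed
    then show ?thesis using greater by simp
  qed
  have "shape_excess T k c = (\<Sum>i<length T. (upto_length k (T ! i) - Suc c) + (if i < ?i then 1 else 0))"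
    unfolding shape_excess_eq
  proof (intro sum.cong refl)
    fix i assume "i \<in> {..<length T}"
    then show "upto_length k (T ! i) - c = upto_length k (T ! i) - Suc c + (if i < ?i then 1 else 0)"
      using long[of i] by auto
  qed
  also have "\<dots> = shape_excess T k (Suc c) + card {i. i < length T \<and> i < ?i}"
    unfolding sum.distrib shape_excess_eq by (simp add: sum.If_cases Int_def)
  also have "{i. i < length T \<and> i < ?i} = {..<?i}" using ri by auto
  finally show ?thesis by simp
qed

lemma shape_excess_0: "shape_excess T 0 c = 0"
proof -
  have "upto_length 0 (T ! i) = 0" if "i < length T" for i
    using that entries[of 0] unfolding upto_length_def
    by (auto simp: filter_empty_conv intro!: gr0I)
  then show ?thesis unfolding shape_excess_eq by simp
qed

end

section \<open>The nilradical\<close>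

lemma set_mset_pos_root: "set_mset (pos_root i j) = {i..j}"
  unfolding pos_root_def by (subst set_mset_sum) auto

text \<open>The support of the root at position (p, q) is the interval from \<open>p + 1\<close> to
  \<open>q\<close>, which is empty unless \<open>p < q\<close>.\<close>

lemma nilradical_iff:
  "A \<in> nilradical N \<tau> \<longleftrightarrow> A \<in> carrier_mat N N \<and>
     (\<forall>p<N. \<forall>q<N. A $$ (p, q) \<noteq> 0 \<longrightarrow> p < q \<and> \<not> {Suc p..q} \<subseteq> \<tau>)"
proof -
  have "pos_root (p + 1) q \<in> pos_roots N - pos_roots_sub N \<tau> \<longleftrightarrow> p < q \<and> \<not> {Suc p..q} \<subseteq> \<tau>"
    if "p < N" "q < N" for p q
  proof -
    have "pos_root (p + 1) q \<in> pos_roots N \<longleftrightarrow> p < q"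
    proof
      assume "pos_root (p + 1) q \<in> pos_roots N"
      then obtain i j where ij: "1 \<le> i" "i \<le> j" "pos_root (p + 1) q = pos_root i j"
        unfolding pos_roots_def by blast
      from arg_cong[OF ij(3), of set_mset] have "{Suc p..q} = {i..j}" by (simp add: set_mset_pos_root)
      then show "p < q" using ij(2) by (metis Suc_le_eq atLeastatMost_empty_iff2)
    next
      assume "p < q"
      then show "pos_root (p + 1) q \<in> pos_roots N"
        unfolding pos_roots_def using that by (intro CollectI exI[of _ "p + 1"] exI[of _ q]) auto
    qed
    then show ?thesis unfolding pos_roots_sub_def by (auto simp: set_mset_pos_root)
  qed
  then show ?thesis unfolding nilradical_def by auto
qed

primrec chain_pos :: "nat set \<Rightarrow> nat \<Rightarrow> nat" where
  "chain_pos \<tau> 0 = 0"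
| "chain_pos \<tau> (Suc k) = (if k \<in> \<tau> then Suc (chain_pos \<tau> k) else 0)"

lemma chain_pos_le: "0 \<notin> \<tau> \<Longrightarrow> chain_pos \<tau> (Suc k) \<le> k"
  by (induction k) auto

text \<open>This number is the predecessor of the first element of the chain of
  \<open>Suc k\<close>; a simple root there would prolong the chain downwards. It is 0 if the chain
  starts at 1, whence the hypothesis.\<close>

lemma chain_start_notin: "0 \<notin> \<tau> \<Longrightarrow> k - chain_pos \<tau> (Suc k) \<notin> \<tau>"
  by (induction k) auto

lemma chain_subset: "0 \<notin> \<tau> \<Longrightarrow> {Suc (k - chain_pos \<tau> (Suc k))..k} \<subseteq> \<tau>"
proof (induction k)
  case (Suc k)
  then show ?case
    by (auto simp: not_less_eq_eq Suc_diff_le chain_pos_le) (metis Suc_leD atLeastAtMost_iff le_SucE subsetD)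
qed simp

definition elem_mat :: "nat \<Rightarrow> nat \<Rightarrow> nat \<Rightarrow> complex mat" where
  "elem_mat N p q = mat N N (\<lambda>(i, j). if i = p \<and> j = q then 1 else 0)"

lemma elem_mat_carrier [simp]: "elem_mat N p q \<in> carrier_mat N N"
  unfolding elem_mat_def by simp

lemma add_elem_mat_index:
  "x \<in> carrier_mat N N \<Longrightarrow> i < N \<Longrightarrow> j < N \<Longrightarrow>
    (x + t \<cdot>\<^sub>m elem_mat N p q) $$ (i, j) = x $$ (i, j) + (if i = p \<and> j = q then t else 0)"
  unfolding elem_mat_def by auto

text \<open>For such \<open>p\<close> the interval \<open>{Suc p..k}\<close> contains the
  predecessor of the chain of \<open>Suc k\<close>, which is not in \<open>\<tau>\<close>. The
  positions of column \<open>k\<close> above the diagonal that are excluded by this bound are the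
  last \<open>chain_pos \<tau> (Suc k)\<close> ones.\<close>

lemma nilradical_add_elem_mat:
  assumes "x \<in> nilradical N \<tau>" "0 \<notin> \<tau>" "k < N" "p < k - chain_pos \<tau> (Suc k)"
  shows "x + t \<cdot>\<^sub>m elem_mat N p k \<in> nilradical N \<tau>"
proof -
  have x: "x \<in> carrier_mat N N" using assms(1) unfolding nilradical_iff by blast
  have "k - chain_pos \<tau> (Suc k) \<in> {Suc p..k}" using assms(4) by simp
  then have notsub: "\<not> {Suc p..k} \<subseteq> \<tau>" using chain_start_notin[OF assms(2), of k] by blast
  show ?thesis unfolding nilradical_iff
  proof (intro conjI allI impI)
    show "x + t \<cdot>\<^sub>m elem_mat N p k \<in> carrier_mat N N" using x by simp
    fix i j
    assume ij: "i < N" "j < N" and nz: "(x + t \<cdot>\<^sub>m elem_mat N p k) $$ (i, j) \<noteq> 0"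
    have "i < j \<and> \<not> {Suc i..j} \<subseteq> \<tau>"
    proof (cases "i = p \<and> j = k")
      case True
      then show ?thesis using notsub assms(4) by auto
    next
      case False
      then have "x $$ (i, j) \<noteq> 0" using nz by (auto simp: add_elem_mat_index[OF x ij] split: if_splits)
      then show ?thesis using assms(1) ij unfolding nilradical_iff by blast
    qed
    then show "i < j" "\<not> {Suc i..j} \<subseteq> \<tau>" by auto
  qed
qed

context
  fixes N k p :: nat and x :: "complex mat" and t :: complex
  assumes x: "x \<in> carrier_mat N N" and k: "k < N" and p: "p < k"
begin

text \<open>Column \<open>k\<close>, counted from 0, lies outside every block of size at most
  \<open>k\<close>. A line in this direction therefore moves the new column only.\<close>

lemma upper_left_act_add_elem_mat:
  "j \<le> k \<Longrightarrow> upper_left_act j (x + t \<cdot>\<^sub>m elem_mat N p k) = upper_left_act j x"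
  using k by (intro ext) (auto simp: upper_left_act_apply add_elem_mat_index[OF x] intro!: sum.cong)

lemma pow_cols_add_elem_mat:
  "j \<le> k \<Longrightarrow> pow_cols j c (x + t \<cdot>\<^sub>m elem_mat N p k) = pow_cols j c x"
  unfolding pow_cols_def by (simp add: upper_left_act_add_elem_mat)

lemma trunc_col_add_elem_mat:
  "trunc_col k k (x + t \<cdot>\<^sub>m elem_mat N p k) = trunc_col k k x + scale_fun t (unit_fun p)"
  using k p by (intro ext) (auto simp: trunc_col_def add_elem_mat_index[OF x] scale_fun_def unit_fun_def)

end

lemma upper_left_act_pow_add_scale:
  "(upper_left_act k x ^^ c) (f + scale_fun t g) =
     (upper_left_act k x ^^ c) f + scale_fun t ((upper_left_act k x ^^ c) g)"
  using fs_pair.linear_add[OF linear_upper_left_act_pow] fs_pair.linear_scale[OF linear_upper_left_act_pow]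
  by simp

text \<open>On strictly upper triangular matrices this is the rank of the larger block with one
  further vector adjoined, the image of a fixed unit vector. Adjoining it makes the condition
  insensitive to motion in the direction \<open>p\<close>.\<close>

lemma closedin_pow_cols_insert:
  assumes "k < N"
  shows "closedin (zariski N) {x \<in> carrier_mat N N.
    fs.dim (insert ((upper_left_act k x ^^ c) (unit_fun p)) (insert ((upper_left_act k x ^^ c) (trunc_col k k x))
      (pow_cols k (Suc c) x))) \<le> s}" (is "closedin _ {x \<in> _. fs.dim (?S x) \<le> s}")
proof -
  define h where "h = (\<lambda>j x. if j < k then (upper_left_act k x ^^ Suc c) (unit_fun j)
    else if j = k then (upper_left_act k x ^^ c) (trunc_col k k x) else (upper_left_act k x ^^ c) (unit_fun p))"
  have "?S x = (\<lambda>j. h j x) ` {..<Suc (Suc k)}" for x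
  proof -
    have "(\<lambda>j. h j x) ` {..<Suc (Suc k)} = insert (h (Suc k) x) (insert (h k x) ((\<lambda>j. h j x) ` {..<k}))"
      by (simp add: lessThan_Suc)
    also have "(\<lambda>j. h j x) ` {..<k} = pow_cols k (Suc c) x"
      unfolding pow_cols_def by (intro image_cong) (auto simp: h_def)
    finally show ?thesis by (simp add: h_def)
  qed
  moreover have "closedin (zariski N) {x \<in> carrier_mat N N. fs.dim ((\<lambda>j. h j x) ` {..<Suc (Suc k)}) \<le> s}"
  \<comment> \<open>For \<open>c = 0\<close> the adjoined vector is \<open>unit_fun p\<close>
    itself, and \<open>p\<close> is arbitrary, so \<open>k\<close> alone does not bound the
    support.\<close>
  proof (rule closedin_dim_le[where n = "max k (Suc p)"])
    fix j i
    have tc: "(\<lambda>x. trunc_col k k x i) \<in> polyfun N" for i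
      using assms by (cases "i < k") (auto simp: trunc_col_def intro: polyfun.entry polyfun.const)
    consider "j < k" | "j = k" | "k < j" by linarith
    then show "(\<lambda>x. h j x i) \<in> polyfun N"
    proof cases
      case 1
      then have "(\<lambda>x. h j x i) = (\<lambda>x. (upper_left_act k x ^^ Suc c) (unit_fun j) i)"
        by (simp only: h_def if_True)
      also have "\<dots> \<in> polyfun N"
        by (rule polyfun_upper_left_act_pow[OF polyfun.const less_imp_le[OF assms]])
      finally show ?thesis .
    next
      case 2
      then have "(\<lambda>x. h j x i) = (\<lambda>x. (upper_left_act k x ^^ c) (trunc_col k k x) i)"
        by (simp add: h_def)
      also have "\<dots> \<in> polyfun N"
        by (rule polyfun_upper_left_act_pow[OF tc less_imp_le[OF assms]])
      finally show ?thesis .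
    next
      case 3
      then have "(\<lambda>x. h j x i) = (\<lambda>x. (upper_left_act k x ^^ c) (unit_fun p) i)"
        by (simp add: h_def)
      also have "\<dots> \<in> polyfun N"
        by (rule polyfun_upper_left_act_pow[OF polyfun.const less_imp_le[OF assms]])
      finally show ?thesis .
    qed
    fix x :: "complex mat"
    assume i: "max k (Suc p) \<le> i"
    have "(upper_left_act k x ^^ c) f i = 0" if "f i = 0" for f c
      using that i by (cases c) (auto simp: upper_left_act_apply)
    then show "h j x i = 0" using i unfolding h_def by (auto simp: unit_fun_def trunc_col_def upper_left_act_apply)
  qed
  ultimately show ?thesis by simp
qed

section \<open>Rank conditions on an orbital variety\<close>

lemma orbital_variety_irreducible:
  assumes "orbital_variety N V"
  shows "irreducible_in (zariski N) V"
  using assms unfolding orbital_variety_def irreducible_component_def irreducible_in_subtopology by blast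

lemma orbital_variety_strictly_upper:
  assumes "orbital_variety N V"
  shows "V \<subseteq> strictly_upper N"
  using assms unfolding orbital_variety_def irreducible_component_def irreducible_in_subtopology by blast

text \<open>The conjugating element is the identity minus the root vector of the negative simple
  root. It is the lower triangular one that feeds column \<open>i + 1\<close>, counted from 1, into
  column \<open>i\<close>.\<close>

lemma tau_invariant_add_col_sub_row:
  assumes "i \<in> tau_invariant N V" "x \<in> V" "V \<subseteq> carrier_mat N N"
  shows "add_col_sub_row 1 i (i - 1) x \<in> V"
proof -
  let ?R = "ring_mat TYPE(complex) N ()"
  let ?g = "addrow_mat N (- 1) i (i - 1) :: complex mat" and ?h = "addrow_mat N 1 i (i - 1) :: complex mat"
  have i: "1 \<le> i" "i < N" using assms(1) unfolding tau_invariant_def by auto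
  have x: "x \<in> carrier_mat N N" using assms by blast
  interpret R: ring ?R by (rule ring_mat)
  interpret G: group "GL N" unfolding GL_def by (rule R.units_group)
  have hg: "?h * ?g = 1\<^sub>m N" by (rule addrow_mat_inv) (use i in auto)
  have "addrow_mat N (- 1) i (i - 1) * addrow_mat N (- (- 1)) i (i - 1) = (1\<^sub>m N :: complex mat)"
    by (rule addrow_mat_inv) (use i in auto)
  then have gh: "?g * ?h = 1\<^sub>m N" by simp
  have "?g \<in> Units ?R" "?h \<in> Units ?R"
    unfolding Units_def ring_mat_simps using gh hg addrow_mat_carrier by blast+
  then have inv: "inv\<^bsub>GL N\<^esub> ?g = ?h"
    using hg by (intro G.inv_equality) (simp_all add: GL_def units_of_def ring_mat_simps)
  have "?g \<in> simple_root_subgroup N i"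
    unfolding simple_root_subgroup_def by (rule generate.incl) blast
  then have "(\<lambda>x. ?g * x * inv\<^bsub>GL N\<^esub> ?g) ` V = V"
    using assms(1) unfolding tau_invariant_def by blast
  then have "?g * x * ?h \<in> V" using assms(2) unfolding inv by blast
  moreover have "add_col_sub_row 1 i (i - 1) x = ?g * x * ?h"
  proof -
    have "addcol 1 (i - 1) i x = x * ?h" by (rule addcol_mat[OF x i(2)])
    moreover have "addrow (- 1) i (i - 1) (x * ?h) = ?g * (x * ?h)"
      by (rule addrow_mat[of _ N N]) (use x i in auto)
    moreover have "?g * x * ?h = ?g * (x * ?h)"
      by (rule assoc_mult_mat[of _ N N _ N _ N]) (use x in auto)
    ultimately show ?thesis unfolding add_col_sub_row_def by simp
  qed
  ultimately show ?thesis by simp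
qed

definition has_tableau :: "nat \<Rightarrow> nat list list \<Rightarrow> complex mat \<Rightarrow> bool" where
  "has_tableau N T x \<longleftrightarrow> (\<forall>k\<in>{1..N}. upper_left k x \<in> nilpotent_orbit k (shape_upto k T))"

lemma generically_has_tableau:
  assumes "orbital_variety N V" "associated_tableau N V T"
  shows "generically (zariski N) V (has_tableau N T)"
  using generically_Ball[OF orbital_variety_irreducible[OF assms(1)], of "{1..N}"] assms(2)
  unfolding associated_tableau_def has_tableau_def by simp

lemma has_tableau_pow_rank:
  assumes "standard_tableau N T" "has_tableau N T x" "k \<le> N"
  shows "pow_rank k c x = shape_excess T k c"
proof (cases k)
  case 0
  interpret std_tableau N T by unfold_locales fact
  have "pow_rank 0 c x \<le> 0"
    using fs.dim_le_card[OF fs.span_superset, of "pow_cols 0 c x"]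
    unfolding pow_rank_def pow_cols_def by simp
  then show ?thesis using 0 shape_excess_0 by simp
next
  case (Suc k')
  then have "upper_left k x \<in> nilpotent_orbit k (shape_upto k T)"
    using assms(2,3) unfolding has_tableau_def by auto
  then show ?thesis
    unfolding pow_rank_eq_mat_rank sum_list_shape_upto[symmetric] by (rule mat_rank_pow_nilpotent_orbit)
qed

text \<open>Both \<open>V\<close> and the Richardson variety satisfy these assumptions, with the
  same \<open>\<tau>\<close>.\<close>

locale orbital_tableau =
  fixes N :: nat and V :: "complex mat set" and T :: "nat list list" and \<tau> :: "nat set"
  assumes orbital: "orbital_variety N V"
    and assoc: "associated_tableau N V T"
    and tau: "\<tau> = tau_invariant N V"
    and sub: "V \<subseteq> nilradical N \<tau>"
begin

sublocale std_tableau N T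
  using assoc unfolding associated_tableau_def by unfold_locales blast

lemma tau_bounds: "i \<in> \<tau> \<Longrightarrow> 1 \<le> i \<and> i < N"
  unfolding tau tau_invariant_def by auto

lemma zero_notin_tau: "0 \<notin> \<tau>"
  using tau_bounds by fastforce

lemma V_carrier: "V \<subseteq> carrier_mat N N"
  using sub unfolding nilradical_def by blast

lemma V_strictly_upper: "V \<subseteq> strictly_upper N"
  by (rule orbital_variety_strictly_upper[OF orbital])

lemma closed_contains:
  assumes "closedin (zariski N) F" "\<And>x. x \<in> V \<Longrightarrow> has_tableau N T x \<Longrightarrow> x \<in> F"
  shows "V \<subseteq> F"
  by (rule generically_closedin_subset[OF orbital_variety_irreducible[OF orbital] generically_has_tableau[OF orbital assoc] assms])

lemma pow_rank_le:
  assumes "k \<le> N" "x \<in> V"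
  shows "pow_rank k c x \<le> shape_excess T k c"
proof -
  have "V \<subseteq> {x \<in> carrier_mat N N. pow_rank k c x \<le> shape_excess T k c}"
    by (rule closed_contains[OF closedin_pow_rank_le[OF assms(1)]])
      (use V_carrier has_tableau_pow_rank[OF std _ assms(1)] in auto)
  then show ?thesis using assms(2) by blast
qed

text \<open>The exponent \<open>c\<close> in the condition on the column added to the block of size
  \<open>k\<close>, that is, the column of the box of \<open>Suc k\<close> counted from 0.\<close>

definition col_idx :: "nat \<Rightarrow> nat" where
  "col_idx k = col_of T (Suc k) - 1"

lemma col_of_Suc: "k < N \<Longrightarrow> col_of T (Suc k) = Suc (col_idx k)"
  unfolding col_idx_def using col_of(1)[of "Suc k"] by simp

lemma shape_excess_col:
  "k < N \<Longrightarrow> shape_excess T (Suc k) (Suc (col_idx k)) = shape_excess T k (Suc (col_idx k))"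
  using shape_excess_Suc[of k "Suc (col_idx k)"] col_of_Suc[of k] by simp

text \<open>Otherwise the rank of the larger block would exceed the bound that holds on all of
  \<open>V\<close>. Genericity is asked of one rank of the smaller block only, so the lemma also
  applies to a conjugate of a generic point.\<close>

lemma trunc_col_in_span:
  assumes "x \<in> V" "k < N" "pow_rank k (Suc (col_idx k)) x = shape_excess T k (Suc (col_idx k))"
  shows "(upper_left_act k x ^^ col_idx k) (trunc_col k k x) \<in> fs.span (pow_cols k (Suc (col_idx k)) x)"
proof (rule ccontr)
  assume "\<not> ?thesis"
  then have "pow_rank (Suc k) (Suc (col_idx k)) x = Suc (pow_rank k (Suc (col_idx k)) x)"
    using pow_rank_Suc[of x N k "col_idx k"] assms V_strictly_upper by auto
  then show False using pow_rank_le[of "Suc k" x "Suc (col_idx k)"] assms shape_excess_col by simp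
qed

text \<open>Conjugation by the root subgroup replaces column \<open>i\<close> by its sum with column \<open>i + 1\<close>, so
  the generic position of column \<open>i\<close> also bounds that of column \<open>i + 1\<close>.\<close>

lemma row_of_descent:
  assumes i: "i \<in> \<tau>"
  shows "row_of T i < row_of T (Suc i)"
proof -
  obtain k where k: "i = Suc k" using tau_bounds[OF i] by (cases i) auto
  have kN: "Suc k < N" "k < N" using tau_bounds[OF i] k by auto
  let ?c = "col_idx k"
  obtain x where x: "x \<in> V" "has_tableau N T x"
    using generically_ex[OF generically_has_tableau[OF orbital assoc]] by blast
  have xc: "x \<in> carrier_mat N N" and xu: "x \<in> strictly_upper N"
    using x V_carrier V_strictly_upper by auto
  define y where "y = add_col_sub_row 1 (Suc k) k x"
  have y: "y \<in> V" unfolding y_def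
    using tau_invariant_add_col_sub_row[of i N V x] i x V_carrier tau k by simp
  \<comment> \<open>The row operation changes row \<open>Suc k\<close> only, so in the rows up to
    \<open>k\<close> just the column operation is visible.\<close>
  have y_idx: "y $$ (r, q) = x $$ (r, q) + (if q = k then x $$ (r, Suc k) else 0)"
    if "r \<le> k" "q < N" for r q
    using that kN xc unfolding y_def by auto
  have act: "upper_left_act k y = upper_left_act k x"
    using kN by (intro ext) (auto simp: upper_left_act_apply y_idx intro!: sum.cong)
  then have cols: "pow_cols k c y = pow_cols k c x" for c unfolding pow_cols_def by simp
  have rk: "pow_rank k c x = shape_excess T k c" for c
    by (rule has_tableau_pow_rank[OF std x(2)]) (use kN in simp)
  have in_x: "(upper_left_act k x ^^ ?c) (trunc_col k k x) \<in> fs.span (pow_cols k (Suc ?c) x)"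
    by (rule trunc_col_in_span[OF x(1) kN(2) rk])
  have in_y: "(upper_left_act k x ^^ ?c) (trunc_col k k y) \<in> fs.span (pow_cols k (Suc ?c) x)"
    using trunc_col_in_span[OF y kN(2)] rk unfolding pow_rank_def cols act by simp
  let ?w = "trunc_col k (Suc k) x"
  have tc: "trunc_col k k y = trunc_col k k x + scale_fun 1 ?w"
    using kN by (intro ext) (auto simp: trunc_col_def scale_fun_def y_idx)
  have "(upper_left_act k x ^^ ?c) (trunc_col k k y) =
    (upper_left_act k x ^^ ?c) (trunc_col k k x) + (upper_left_act k x ^^ ?c) ?w"
    unfolding tc upper_left_act_pow_add_scale by (simp only: fs.scale_one)
  \<comment> \<open>Columns \<open>k\<close> of \<open>x\<close> and of its conjugate satisfy the
    same linear condition, hence so does their difference, column \<open>Suc k\<close> of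
    \<open>x\<close> cut off after \<open>k\<close> rows.\<close>
  then have in_w: "(upper_left_act k x ^^ ?c) ?w \<in> fs.span (pow_cols k (Suc ?c) x)"
    using fs.span_diff[OF in_y in_x] by simp
  \<comment> \<open>The position of the simple root itself vanishes on the nilradical, so cutting
    this column after \<open>k\<close> or after \<open>Suc k\<close> rows gives the same
    vector.\<close>
  have "x $$ (k, Suc k) = 0"
  proof (rule ccontr)
    assume "x $$ (k, Suc k) \<noteq> 0"
    moreover have "x \<in> nilradical N \<tau>" using x sub by blast
    ultimately have "\<not> {Suc k..Suc k} \<subseteq> \<tau>" using kN unfolding nilradical_iff by blast
    then show False using i k by simp
  qed
  then have w: "trunc_col (Suc k) (Suc k) x = ?w" by (auto simp: trunc_col_def fun_eq_iff less_Suc_eq)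
  have "(upper_left_act (Suc k) x ^^ ?c) ?w = (upper_left_act k x ^^ ?c) ?w"
    by (rule upper_left_act_pow_Suc[OF xu kN(2)]) (simp add: trunc_col_def)
  then have "(upper_left_act (Suc k) x ^^ ?c) (trunc_col (Suc k) (Suc k) x)
      \<in> fs.span (pow_cols (Suc k) (Suc ?c) x)"
    using in_w w fs.span_mono[of "pow_cols k (Suc ?c) x" "pow_cols (Suc k) (Suc ?c) x"]
    unfolding pow_cols_Suc[OF xu kN(2)] by auto
  then have "pow_rank (Suc (Suc k)) (Suc ?c) x = pow_rank (Suc k) (Suc ?c) x"
    using pow_rank_Suc[OF xu kN(1), of ?c] by simp
  then have "shape_excess T (Suc (Suc k)) (Suc ?c) = shape_excess T (Suc k) (Suc ?c)"
    using has_tableau_pow_rank[OF std x(2)] kN by simp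
  then have "col_of T (Suc (Suc k)) \<le> Suc ?c"
    using shape_excess_Suc[of "Suc k" "Suc ?c"] kN by (simp split: if_splits)
  then show ?thesis using row_of_less[of "Suc k" "Suc (Suc k)"] kN col_of_Suc[OF kN(2)] k by simp
qed

lemma chain_pos_le_row: "k \<le> N \<Longrightarrow> chain_pos \<tau> k \<le> row_of T k"
proof (induction k)
  case (Suc k)
  then show ?case using row_of_descent[of k] by auto
qed simp

text \<open>By \<open>shape_excess_row\<close> the rank drops by exactly
  \<open>row_of T (Suc k)\<close>, more than \<open>W\<close> and the last \<open>s\<close> unit
  vectors can absorb. With \<open>s\<close> the chain position, the direction found stays in the
  nilradical.\<close>

lemma ex_unit_notin_span:
  assumes x: "has_tableau N T x" and k: "k < N"
    and W: "finite W" "card W + s < row_of T (Suc k)"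
  shows "\<exists>p<k - s. (upper_left_act k x ^^ col_idx k) (unit_fun p)
    \<notin> fs.span (pow_cols k (Suc (col_idx k)) x \<union> W)"
proof (rule ccontr)
  assume "\<not> ?thesis"
  then have "pow_rank k (col_idx k) x \<le> pow_rank k (Suc (col_idx k)) x + card W + s"
    using pow_rank_jump_le[OF W(1), of k s "col_idx k" x] by blast
  then show False
    using has_tableau_pow_rank[OF std x] shape_excess_row[of k "col_idx k"] col_of_Suc[OF k] k W(2) by simp
qed

text \<open>At \<open>x\<close> the new column already satisfies its condition, so after the shift
  it violates the condition because \<open>unit_fun p\<close> does.\<close>

lemma pow_rank_add_elem_mat:
  assumes x: "x \<in> V" "has_tableau N T x" and k: "k < N" and p: "p < k"
    and out: "(upper_left_act k x ^^ col_idx k) (unit_fun p) \<notin> fs.span (pow_cols k (Suc (col_idx k)) x)"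
  shows "shape_excess T (Suc k) (Suc (col_idx k)) <
    pow_rank (Suc k) (Suc (col_idx k)) (x + 1 \<cdot>\<^sub>m elem_mat N p k)"
proof -
  let ?y = "x + 1 \<cdot>\<^sub>m elem_mat N p k" and ?c = "col_idx k"
  have xc: "x \<in> carrier_mat N N" and xu: "x \<in> strictly_upper N"
    using x V_carrier V_strictly_upper by auto
  have yu: "?y \<in> strictly_upper N"
    using xu p unfolding strictly_upper_def by (auto simp: add_elem_mat_index)
  have rk: "pow_rank k c x = shape_excess T k c" for c
    by (rule has_tableau_pow_rank[OF std x(2)]) (use k in simp)
  have col: "(upper_left_act k ?y ^^ ?c) (trunc_col k k ?y) =
    (upper_left_act k x ^^ ?c) (trunc_col k k x) + (upper_left_act k x ^^ ?c) (unit_fun p)"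
    unfolding upper_left_act_add_elem_mat[OF xc k p order_refl] trunc_col_add_elem_mat[OF xc k p]
      upper_left_act_pow_add_scale by simp
  have "(upper_left_act k ?y ^^ ?c) (trunc_col k k ?y) \<notin> fs.span (pow_cols k (Suc ?c) x)"
  proof
    assume "(upper_left_act k ?y ^^ ?c) (trunc_col k k ?y) \<in> fs.span (pow_cols k (Suc ?c) x)"
    from fs.span_diff[OF this trunc_col_in_span[OF x(1) k rk]] show False using out unfolding col by simp
  qed
  then have "pow_rank (Suc k) (Suc ?c) ?y = Suc (pow_rank k (Suc ?c) x)"
    unfolding pow_rank_Suc[OF yu k] unfolding pow_rank_def pow_cols_add_elem_mat[OF xc k p order_refl] by simp
  then show ?thesis using rk shape_excess_col[OF k] by simp
qed

lemma excess_row_nilradical: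
  assumes k: "k < N" and r: "chain_pos \<tau> (Suc k) < row_of T (Suc k)"
  shows "\<exists>y\<in>nilradical N \<tau>. shape_excess T (Suc k) (Suc (col_idx k)) < pow_rank (Suc k) (Suc (col_idx k)) y"
proof -
  obtain x where x: "x \<in> V" "has_tableau N T x"
    using generically_ex[OF generically_has_tableau[OF orbital assoc]] by blast
  obtain p where p: "p < k - chain_pos \<tau> (Suc k)"
    "(upper_left_act k x ^^ col_idx k) (unit_fun p) \<notin> fs.span (pow_cols k (Suc (col_idx k)) x)"
    using ex_unit_notin_span[OF x(2) k, of "{}"] r by auto
  have "x + 1 \<cdot>\<^sub>m elem_mat N p k \<in> nilradical N \<tau>"
    using nilradical_add_elem_mat[OF _ zero_notin_tau k p(1)] x(1) sub by blast
  moreover have "p < k" using p(1) by simp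
  ultimately show ?thesis using pow_rank_add_elem_mat[OF x k _ p(2)] by blast
qed

end

section \<open>Hypersurface orbital varieties\<close>

text \<open>The rank bounds on \<open>V\<close> extend to its closure, whereas an excess would
  provide a point of the nilradical that breaks one of them.\<close>

lemma (in orbital_tableau) row_of_dense:
  assumes "zariski N closure_of V = nilradical N \<tau>" "k < N"
  shows "row_of T (Suc k) = chain_pos \<tau> (Suc k)"
proof (rule ccontr)
  assume ne: "row_of T (Suc k) \<noteq> chain_pos \<tau> (Suc k)"
  have "chain_pos \<tau> (Suc k) \<le> row_of T (Suc k)" by (rule chain_pos_le_row) (use assms(2) in simp)
  then have "chain_pos \<tau> (Suc k) < row_of T (Suc k)" using ne by (rule le_neq_trans[OF _ not_sym])
  from excess_row_nilradical[OF assms(2) this] obtain y where y: "y \<in> zariski N closure_of V"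
    "shape_excess T (Suc k) (Suc (col_idx k)) < pow_rank (Suc k) (Suc (col_idx k)) y"
    unfolding assms(1) by blast
  have "zariski N closure_of V \<subseteq>
    {x \<in> carrier_mat N N. pow_rank (Suc k) (Suc (col_idx k)) x \<le> shape_excess T (Suc k) (Suc (col_idx k))}"
    by (rule closure_of_minimal[OF _ closedin_pow_rank_le])
      (use V_carrier pow_rank_le assms(2) in auto)
  then show False using y by auto
qed

text \<open>The two further assumptions make the nilradical itself an admissible top of a chain of
  irreducible closed sets.\<close>

locale hypersurface_tableau = orbital_tableau +
  assumes hyper: "hypersurface_in (subtopology (zariski N) (nilradical N \<tau>)) (zariski N closure_of V)"
    and nilradical_irreducible: "irreducible_in (zariski N) (nilradical N \<tau>)"
    and nilradical_closed: "closedin (zariski N) (nilradical N \<tau>)"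
begin

lemma cylinder_dense:
  assumes x: "x \<in> V" "has_tableau N T x" and k: "k < N" and p: "p < k - chain_pos \<tau> (Suc k)"
    and out: "(upper_left_act k x ^^ col_idx k) (unit_fun p) \<notin> fs.span (pow_cols k (Suc (col_idx k)) x)"
    and F: "closedin (zariski N) F" "\<And>z t. z \<in> V \<Longrightarrow> z + t \<cdot>\<^sub>m elem_mat N p k \<in> F"
  shows "nilradical N \<tau> \<subseteq> F"
proof -
  let ?m = "nilradical N \<tau>" and ?C = "{z + t \<cdot>\<^sub>m elem_mat N p k |z t. z \<in> V}"
  let ?X = "subtopology (zariski N) ?m" and ?W = "zariski N closure_of ?C"
  have Cm: "?C \<subseteq> ?m"
    using nilradical_add_elem_mat[OF _ zero_notin_tau k p] sub by blast
  have Wm: "?W \<subseteq> ?m" by (rule closure_of_minimal[OF Cm nilradical_closed])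
  have CW: "?C \<subseteq> ?W"
    by (rule closure_of_subset) (use V_carrier in \<open>auto simp: topspace_zariski\<close>)
  have top: "topspace ?X = ?m"
    using closedin_subset[OF nilradical_closed] by (simp add: Int_absorb1)
  have "irreducible_in (zariski N) ?C"
    by (rule irreducible_in_cylinder[OF orbital_variety_irreducible[OF orbital]]) simp
  then have "irreducible_in (zariski N) ?W" by (rule irreducible_in_between_closure[OF _ CW order_refl])
  then have irr: "irreducible_in ?X ?W" unfolding irreducible_in_subtopology using Wm by blast
  have cl: "closedin ?X ?W"
    unfolding closedin_subtopology using closedin_closure_of Wm by blast
  have irrX: "irreducible_in ?X (topspace ?X)"
    unfolding top irreducible_in_subtopology using nilradical_irreducible by blast
  have "z = z + 0 \<cdot>\<^sub>m elem_mat N p k" if "z \<in> V" for z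
    using that V_carrier by (intro eq_matI) (auto simp: add_elem_mat_index elem_mat_def)
  then have "V \<subseteq> ?C" by blast
  then have sub': "zariski N closure_of V \<subseteq> ?W" by (rule closure_of_mono)
  \<comment> \<open>This closed condition separates: the closure of \<open>V\<close> satisfies it,
    the point of the cylinder over \<open>x\<close> at parameter 1 does not. Hence the inclusion of
    closures is strict.\<close>
  let ?G = "{y \<in> carrier_mat N N. pow_rank (Suc k) (Suc (col_idx k)) y \<le> shape_excess T (Suc k) (Suc (col_idx k))}"
  have "zariski N closure_of V \<subseteq> ?G"
    by (rule closure_of_minimal[OF _ closedin_pow_rank_le]) (use V_carrier pow_rank_le k in auto)
  moreover have "x + 1 \<cdot>\<^sub>m elem_mat N p k \<notin> ?G"
    using pow_rank_add_elem_mat[OF x k _ out] less_le_trans[OF p diff_le_self] by auto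
  moreover have "x + 1 \<cdot>\<^sub>m elem_mat N p k \<in> ?W" using CW x(1) by blast
  ultimately have "zariski N closure_of V \<subset> ?W" using sub' by blast
  then have "?W = ?m" using hypersurface_in_maximal[OF hyper cl irr _ irrX] top by simp
  moreover have "?W \<subseteq> F" by (rule closure_of_minimal[OF _ F(1)]) (use F(2) in blast)
  ultimately show ?thesis by simp
qed

text \<open>The direction is taken in column \<open>k\<close>, outside the block of size
  \<open>Suc j\<close>, so the condition attached to \<open>Suc j\<close> holds on the cylinder and
  then on the nilradical. A direction in column \<open>j\<close> would alter the block of size
  \<open>k\<close>.\<close>

lemma excess_unique:
  assumes "j < k" "k < N" "chain_pos \<tau> (Suc j) < row_of T (Suc j)" "chain_pos \<tau> (Suc k) < row_of T (Suc k)"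
  shows False
proof -
  obtain x where x: "x \<in> V" "has_tableau N T x"
    using generically_ex[OF generically_has_tableau[OF orbital assoc]] by blast
  obtain p where p: "p < k - chain_pos \<tau> (Suc k)"
    "(upper_left_act k x ^^ col_idx k) (unit_fun p) \<notin> fs.span (pow_cols k (Suc (col_idx k)) x)"
    using ex_unit_notin_span[OF x(2) assms(2), of "{}"] assms(4) by auto
  let ?r = "pow_rank (Suc j) (Suc (col_idx j))" and ?R = "shape_excess T (Suc j) (Suc (col_idx j))"
  let ?F = "{y \<in> carrier_mat N N. ?r y \<le> ?R}"
  have "nilradical N \<tau> \<subseteq> ?F"
  proof (rule cylinder_dense[OF x assms(2) p closedin_pow_rank_le])
    show "Suc j \<le> N" using assms(1,2) by simp
    fix z t assume z: "z \<in> V"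
    have "?r (z + t \<cdot>\<^sub>m elem_mat N p k) = ?r z"
      unfolding pow_rank_def using z V_carrier assms(1,2) p(1)
      by (subst pow_cols_add_elem_mat) auto
    then show "z + t \<cdot>\<^sub>m elem_mat N p k \<in> ?F"
      using pow_rank_le[of "Suc j" z] assms(1,2) z V_carrier by auto
  qed
  then show False using excess_row_nilradical[of j] assms by fastforce
qed

text \<open>An excess of two leaves room for a second direction \<open>q\<close> independent of \<open>p\<close>, so the cylinder
  in direction \<open>p\<close> satisfies a rank condition that fails on the nilradical.\<close>

lemma excess_le_Suc:
  assumes k: "k < N"
  shows "row_of T (Suc k) \<le> Suc (chain_pos \<tau> (Suc k))"
proof (rule ccontr)
  assume big: "\<not> ?thesis"
  let ?s = "chain_pos \<tau> (Suc k)" and ?c = "col_idx k"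
  obtain x where x: "x \<in> V" "has_tableau N T x"
    using generically_ex[OF generically_has_tableau[OF orbital assoc]] by blast
  have xc: "x \<in> carrier_mat N N" using x V_carrier by blast
  let ?U = "upper_left_act k x ^^ ?c" and ?P = "pow_cols k (Suc ?c) x"
  obtain p where p: "p < k - ?s" "?U (unit_fun p) \<notin> fs.span ?P"
    using ex_unit_notin_span[OF x(2) k, of "{}" ?s] big by (auto simp: not_le)
  \<comment> \<open>An excess of at least two leaves room for \<open>W\<close> to have one
    element.\<close>
  obtain q where q: "q < k - ?s" "?U (unit_fun q) \<notin> fs.span (?P \<union> {?U (unit_fun p)})"
    using ex_unit_notin_span[OF x(2) k, of "{?U (unit_fun p)}" ?s] big by (auto simp: not_le)
  \<comment> \<open>Along the direction \<open>p\<close> the new column changes by a multiple of the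
    adjoined vector, so the span of \<open>S\<close> does not grow. Over \<open>V\<close> its
    dimension is at most the rank of the larger block plus one.\<close>
  define S where "S = (\<lambda>y. insert ((upper_left_act k y ^^ ?c) (unit_fun p))
    (insert ((upper_left_act k y ^^ ?c) (trunc_col k k y)) (pow_cols k (Suc ?c) y)))"
  let ?R = "Suc (shape_excess T k (Suc ?c))"
  let ?F = "{y \<in> carrier_mat N N. fs.dim (S y) \<le> ?R}"
  have clF: "closedin (zariski N) ?F" unfolding S_def by (rule closedin_pow_cols_insert[OF k])
  have "nilradical N \<tau> \<subseteq> ?F"
  proof (rule cylinder_dense[OF x k p clF])
    fix z t assume z: "z \<in> V"
    have zc: "z \<in> carrier_mat N N" and zu: "z \<in> strictly_upper N"
      using z V_carrier V_strictly_upper by auto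
    let ?y = "z + t \<cdot>\<^sub>m elem_mat N p k"
    have pk: "p < k" using p(1) by simp
    have act: "upper_left_act k ?y = upper_left_act k z"
      by (rule upper_left_act_add_elem_mat[OF zc k pk order_refl])
    have cols: "pow_cols k (Suc ?c) ?y = pow_cols k (Suc ?c) z"
      by (rule pow_cols_add_elem_mat[OF zc k pk order_refl])
    have "(upper_left_act k z ^^ ?c) (trunc_col k k ?y) \<in> fs.span (S z)"
      unfolding trunc_col_add_elem_mat[OF zc k pk] upper_left_act_pow_add_scale
      by (intro fs.span_add fs.span_scale fs.span_base) (auto simp: S_def)
    moreover have "(upper_left_act k z ^^ ?c) (unit_fun p) \<in> fs.span (S z)"
      by (intro fs.span_base) (simp add: S_def)
    moreover have "pow_cols k (Suc ?c) z \<subseteq> fs.span (S z)"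
      using fs.span_superset[of "S z"] unfolding S_def by blast
    ultimately have "S ?y \<subseteq> fs.span (S z)" unfolding S_def act cols by blast
    moreover have fin: "finite (S z)" unfolding S_def by simp
    ultimately have "fs.dim (S ?y) \<le> fs.dim (S z)" by (intro fs.dim_mono_finite)
    also have "S z = pow_cols (Suc k) (Suc ?c) z \<union> {(upper_left_act k z ^^ ?c) (unit_fun p)}"
      unfolding S_def pow_cols_Suc[OF zu k] by blast
    also have "fs.dim \<dots> \<le> pow_rank (Suc k) (Suc ?c) z + 1"
      unfolding pow_rank_def using fs.dim_Un_le_card[of "pow_cols (Suc k) (Suc ?c) z" "{(upper_left_act k z ^^ ?c) (unit_fun p)}"]
      by simp
    also have "\<dots> \<le> ?R" using pow_rank_le[of "Suc k" z "Suc ?c"] z k shape_excess_col[OF k] by simp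
    finally show "?y \<in> ?F" using zc by simp
  qed
  moreover
  let ?y = "x + 1 \<cdot>\<^sub>m elem_mat N q k"
  have qk: "q < k" using q(1) by simp
  have "?y \<in> nilradical N \<tau>"
    using nilradical_add_elem_mat[OF _ zero_notin_tau k q(1)] x(1) sub by blast
  \<comment> \<open>Moving along \<open>q\<close> makes both the image of the new column and the
    adjoined vector independent of the old image, which adds two dimensions.\<close>
  moreover have "fs.dim (S ?y) = Suc ?R"
  proof -
    have rk: "pow_rank k (Suc ?c) x = shape_excess T k (Suc ?c)"
      by (rule has_tableau_pow_rank[OF std x(2)]) (use k in simp)
    have act: "upper_left_act k ?y = upper_left_act k x"
      by (rule upper_left_act_add_elem_mat[OF xc k qk order_refl])
    have cols: "pow_cols k (Suc ?c) ?y = ?P"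
      by (rule pow_cols_add_elem_mat[OF xc k qk order_refl])
    have tcol: "?U (trunc_col k k ?y) = ?U (trunc_col k k x) + ?U (unit_fun q)"
      unfolding trunc_col_add_elem_mat[OF xc k qk] upper_left_act_pow_add_scale by simp
    let ?Q = "insert (?U (unit_fun p)) ?P"
    have "?U (trunc_col k k x) \<in> fs.span ?Q"
      using trunc_col_in_span[OF x(1) k rk] fs.span_mono[of ?P ?Q] by blast
    then have notin: "?U (trunc_col k k ?y) \<notin> fs.span ?Q"
      using fs.span_diff[of "?U (trunc_col k k ?y)" ?Q "?U (trunc_col k k x)"] q(2)
      unfolding tcol by auto
    have "S ?y = insert (?U (trunc_col k k ?y)) ?Q"
      unfolding S_def act cols by blast
    then have "fs.dim (S ?y) = Suc (fs.dim ?Q)" using notin by (simp add: fs.dim_insert_finite)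
    also have "fs.dim ?Q = Suc (fs.dim ?P)" using p(2) by (simp add: fs.dim_insert_finite)
    finally show ?thesis using rk unfolding pow_rank_def by simp
  qed
  ultimately show False by auto
qed

end

section \<open>Recovering a tableau from the rows of its entries\<close>

context std_tableau
begin

lemma set_row: "i < length T \<Longrightarrow> set (T ! i) = {k \<in> {1..N}. row_of T k = i}"
  using entries row_of row_of_eq by blast

text \<open>Rows are nonempty, so \<open>row_of\<close> also determines how many there are.\<close>

lemma row_image: "row_of T ` {1..N} = {..<length T}"
proof -
  have "i \<in> row_of T ` {1..N}" if "i < length T" for i
    using hd_in_set[OF row_nonempty[OF that]] unfolding set_row[OF that]
    by (intro image_eqI[of _ _ "hd (T ! i)"]) simp_all
  then show ?thesis using row_of by blast
qed

lemma eqI: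
  assumes len: "length L = length T"
    and rows: "\<And>i. i < length T \<Longrightarrow> sorted_wrt (<) (L ! i) \<and> set (L ! i) = {k \<in> {1..N}. row_of T k = i}"
  shows "T = L"
  by (rule nth_equalityI[OF len[symmetric]], rule strict_sorted_equal)
     (use rows row_sorted set_row in auto)

end

lemma tableau_eqI:
  assumes "standard_tableau N T" "standard_tableau N T'"
    and rows: "\<And>k. k \<in> {1..N} \<Longrightarrow> row_of T k = row_of T' k"
  shows "T = T'"
proof -
  interpret A: std_tableau N T by unfold_locales fact
  interpret B: std_tableau N T' by unfold_locales fact
  have "{..<length T'} = {..<length T}"
    using A.row_image B.row_image rows by (metis image_cong)
  then have len: "length T' = length T" by (simp add: lessThan_eq_iff)
  have "{k \<in> {1..N}. row_of T' k = i} = {k \<in> {1..N}. row_of T k = i}" for i using rows by auto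
  then show ?thesis using len by (intro A.eqI) (simp_all add: B.row_sorted B.set_row)
qed

text \<open>\<open>row_of\<close> counts rows from 0 and \<open>move_box\<close> from 1, whence
  \<open>Suc\<close>. Both sides consist of increasing lists, so comparing lengths and the sets of
  entries row by row suffices.\<close>

lemma tableau_eq_move_box:
  assumes "standard_tableau N T" "standard_tableau N T'"
    and m: "m \<in> {1..N}" "row_of T m = Suc (row_of T' m)"
    and rows: "\<And>k. k \<in> {1..N} \<Longrightarrow> k \<noteq> m \<Longrightarrow> row_of T k = row_of T' k"
  shows "T = move_box m (Suc (row_of T' m)) T'"
proof -
  interpret A: std_tableau N T by unfold_locales fact
  interpret B: std_tableau N T' by unfold_locales fact
  let ?s = "row_of T' m"
  define L where "L = (if Suc ?s < length T' then T' else T' @ [[]])"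
  have sl: "?s < length T'" by (rule B.row_of(1)[OF m(1)])
  have lenL: "length L = max (length T') (Suc (Suc ?s))" using sl unfolding L_def by auto
  have img: "{..<length T} = {..<length L}"
  proof -
    have up: "row_of T k < length L" if "k \<in> {1..N}" for k
      using rows[OF that] B.row_of(1)[OF that] m(2) lenL by (cases "k = m") auto
    \<comment> \<open>\<open>T\<close> has a row \<open>Suc ?s\<close>, which contains
      \<open>m\<close>, and hence all rows before it; the entries of later rows are the same in both
      tableaux.\<close>
    have down: "i < length T" if "i < length L" for i
    proof -
      have top: "Suc ?s < length T" using A.row_of(1)[OF m(1)] m(2) by simp
      show ?thesis
      proof (cases "i \<le> Suc ?s")
        case False
        then have "i < length T'" using that lenL by auto
        then have "i \<in> row_of T' ` {1..N}" unfolding B.row_image by simp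
        then obtain k where k: "k \<in> {1..N}" "row_of T' k = i" by blast
        then have "row_of T k = i" using rows[OF k(1)] False by (cases "k = m") auto
        then show ?thesis using A.row_of(1)[OF k(1)] by simp
      qed (use top in simp)
    qed
    have "row_of T ` {1..N} \<subseteq> {..<length L}" by (rule image_subsetI) (use up in simp)
    moreover have "{..<length L} \<subseteq> {..<length T}" by (rule subsetI) (use down in simp)
    ultimately show ?thesis unfolding A.row_image by (rule subset_antisym)
  qed
  then have len: "length L = length T" by (simp add: lessThan_eq_iff)
  have rows_iff: "row_of T k = i \<longleftrightarrow> (if k = m then i = Suc ?s else row_of T' k = i)" if "k \<in> {1..N}" for k i
    using m(2) rows[OF that] by auto
  have rowL: "sorted (L ! i) \<and> distinct (L ! i) \<and> set (L ! i) = {k \<in> {1..N}. row_of T' k = i}"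
    if "i < length L" for i
  proof (cases "i < length T'")
    case True
    then have "L ! i = T' ! i" unfolding L_def by (simp add: nth_append)
    then show ?thesis using B.row_sorted[OF True] B.set_row[OF True] by (simp add: strict_sorted_iff)
  next
    case False
    then have "L ! i = []" using that lenL sl unfolding L_def by (auto simp: nth_append split: if_splits)
    moreover have "{k \<in> {1..N}. row_of T' k = i} = {}" using B.row_of(1) False by auto
    ultimately show ?thesis by simp
  qed
  let ?M = "L[?s := remove1 m (L ! ?s), Suc ?s := insort m (L ! Suc ?s)]"
  have "T = ?M"
  proof (rule A.eqI)
    show "length ?M = length T" using len by simp
    fix i assume i: "i < length T"
    have "?M ! i = (if i = Suc ?s then insort m (L ! i) else if i = ?s then remove1 m (L ! i) else L ! i)"
      using i len by (simp add: nth_list_update)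
    moreover have "sorted (insort m (L ! i)) \<and> distinct (insort m (L ! i)) \<and>
      set (insort m (L ! i)) = {k \<in> {1..N}. row_of T k = i}" if ii: "i = Suc ?s"
    proof -
      have "{k \<in> {1..N}. row_of T k = i} = insert m {k \<in> {1..N}. row_of T' k = i}"
        using m(1) ii by (auto simp: rows_iff split: if_splits)
      moreover have "m \<notin> set (L ! i)" using rowL[of i] i len ii by simp
      ultimately show ?thesis using rowL[of i] i len
        by (simp add: sorted_insort distinct_insort set_insort_key)
    qed
    moreover have "sorted (remove1 m (L ! i)) \<and> distinct (remove1 m (L ! i)) \<and>
      set (remove1 m (L ! i)) = {k \<in> {1..N}. row_of T k = i}" if ii: "i = ?s"
    proof -
      have "{k \<in> {1..N}. row_of T k = i} = {k \<in> {1..N}. row_of T' k = i} - {m}"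
        using m(1) ii by (auto simp: rows_iff split: if_splits)
      then show ?thesis using rowL[of i] i len
        by (simp add: sorted_remove1 distinct_remove1 set_remove1_eq)
    qed
    moreover have "{k \<in> {1..N}. row_of T k = i} = {k \<in> {1..N}. row_of T' k = i}"
      if ne: "i \<noteq> ?s" "i \<noteq> Suc ?s"
    proof -
      have "row_of T k = i \<longleftrightarrow> row_of T' k = i" if "k \<in> {1..N}" for k
        using rows_iff[OF that, of i] ne by (cases "k = m") auto
      then show ?thesis by blast
    qed
    ultimately show "sorted_wrt (<) (?M ! i) \<and> set (?M ! i) = {k \<in> {1..N}. row_of T k = i}"
      using rowL[of i] i len by (simp add: strict_sorted_iff)
  qed
  then show ?thesis unfolding move_box_def L_def Let_def by simp
qed

text \<open>The interval is stable since neither \<open>m\<close> nor the predecessor of its first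
  element lies in \<open>\<tau>\<close>, and every element is reached from \<open>m\<close> by
  descending one transposition at a time.\<close>

lemma chain_in_tau_chains:
  assumes tau: "\<tau> \<subseteq> {1..<N}" and m: "m \<in> {1..N}" "m \<notin> \<tau>"
  shows "{m - chain_pos \<tau> m..m} \<in> tau_chains N \<tau>"
proof -
  obtain k where k: "m = Suc k" using m by (cases m) auto
  let ?s = "chain_pos \<tau> m" and ?C = "{m - chain_pos \<tau> m..m}"
  let ?H = "{Transposition.transpose i (i + 1) |i. i \<in> \<tau>}"
  let ?G = "generate (sym_group N) ?H"
  have z: "0 \<notin> \<tau>" using tau by auto
  have sk: "?s \<le> k" using chain_pos_le[OF z, of k] k by simp
  have start: "k - ?s \<notin> \<tau>" using chain_start_notin[OF z, of k] k by simp
  have inner: "{Suc (k - ?s)..k} \<subseteq> \<tau>" using chain_subset[OF z, of k] k by simp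
  interpret S: group "sym_group N" by (rule sym_group_is_group)
  have perm: "h permutes {1..N}" if "h \<in> ?H" for h
  proof -
    from that obtain i where i: "h = Transposition.transpose i (i + 1)" "i \<in> \<tau>" by blast
    then have "i \<in> {1..N}" "i + 1 \<in> {1..N}" using tau by auto
    then show ?thesis unfolding i(1) by (rule permutes_swap_id)
  qed
  \<comment> \<open>The generators are involutions, so the inverse clause of \<open>generate\<close>
    adds nothing new.\<close>
  have inv: "inv\<^bsub>sym_group N\<^esub> h = h" if "h \<in> ?H" for h
  proof (rule S.inv_equality)
    show "h \<in> carrier (sym_group N)" "h \<in> carrier (sym_group N)"
      using perm[OF that] by (simp_all add: sym_group_carrier)
    show "h \<otimes>\<^bsub>sym_group N\<^esub> h = \<one>\<^bsub>sym_group N\<^esub>"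
      using that by (auto simp: sym_group_mult sym_group_one)
  qed
  have stepC: "h y \<in> ?C" if h: "h \<in> ?H" and y: "y \<in> ?C" for h y
  proof -
    from h obtain i where i: "h = Transposition.transpose i (i + 1)" "i \<in> \<tau>" by blast
    have "i \<noteq> m" using i(2) m(2) by blast
    moreover have "i + 1 \<noteq> m - ?s"
    proof
      assume "i + 1 = m - ?s"
      then have "i = k - ?s" using k by simp
      then show False using start i(2) by simp
    qed
    ultimately show ?thesis using y unfolding i(1) by (auto simp: Transposition.transpose_def)
  qed
  have stay: "\<forall>y\<in>?C. g y \<in> ?C" if "g \<in> ?G" for g
    using that
  proof (induction g rule: generate.induct)
    case (inv h)
    have eq: "inv\<^bsub>sym_group N\<^esub> h = h" by (rule \<open>h \<in> ?H \<Longrightarrow> inv\<^bsub>sym_group N\<^esub> h = h\<close>[OF inv])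
    show ?case unfolding eq using stepC[OF inv] by blast
  next
    case (incl h)
    show ?case using stepC[OF incl] by blast
  qed (simp_all add: sym_group_one sym_group_mult)
  have reach: "j \<le> ?s \<Longrightarrow> \<exists>g\<in>?G. g m = m - j" for j
  proof (induction j)
    case 0
    show ?case using generate.one[of "sym_group N" ?H] by (auto simp: sym_group_one intro!: bexI[of _ id])
  next
    case (Suc j)
    then obtain g where g: "g \<in> ?G" "g m = m - j" by auto
    let ?i = "m - Suc j"
    have "?i \<in> {Suc (k - ?s)..k}" using Suc.prems sk k by auto
    then have "?i \<in> \<tau>" using inner by blast
    then have "Transposition.transpose ?i (?i + 1) \<in> ?G" by (intro generate.incl) blast
    from generate.eng[OF this g(1)]
    have "Transposition.transpose ?i (?i + 1) \<circ> g \<in> ?G" by (simp add: sym_group_mult)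
    moreover have "?i + 1 = m - j" using Suc.prems sk k by auto
    ultimately show ?case using g(2)
      by (intro bexI[of _ "Transposition.transpose ?i (?i + 1) \<circ> g"]) auto
  qed
  have "(\<lambda>g. g m) ` ?G = ?C"
  proof
    show "(\<lambda>g. g m) ` ?G \<subseteq> ?C" using stay by fastforce
    show "?C \<subseteq> (\<lambda>g. g m) ` ?G"
    proof
      fix y assume y: "y \<in> ?C"
      then have "m - y \<le> ?s" "m - (m - y) = y" by auto
      then obtain g where "g \<in> ?G" "g m = y" using reach[of "m - y"] by auto
      then show "y \<in> (\<lambda>g. g m) ` ?G" by blast
    qed
  qed
  then show ?thesis unfolding tau_chains_def using m(1) by blast
qed

section \<open>Orbital varieties with the same tableau as components of one orbit\<close>

lemma nilpotent_orbit_eqI: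
  assumes "x \<in> nilpotent_orbit N \<mu>" "x \<in> nilpotent_orbit N \<nu>"
  shows "nilpotent_orbit N \<mu> = nilpotent_orbit N \<nu>"
proof -
  have "nilpotent_orbit N \<mu> \<subseteq> nilpotent_orbit N \<nu>"
    if "x \<in> nilpotent_orbit N \<mu>" "x \<in> nilpotent_orbit N \<nu>" for \<mu> \<nu>
  proof
    fix y assume "y \<in> nilpotent_orbit N \<mu>"
    then have y: "y \<in> carrier_mat N N" "similar_mat y (jordan_matrix (map (\<lambda>k. (k, 0)) \<mu>))"
      unfolding nilpotent_orbit_def jordan_nf_def by blast+
    have x: "similar_mat x (jordan_matrix (map (\<lambda>k. (k, 0)) \<mu>))"
      "jordan_nf x (map (\<lambda>k. (k, 0)) \<nu>)"
      using that unfolding nilpotent_orbit_def jordan_nf_def by blast+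
    have "similar_mat y x" by (rule similar_mat_trans[OF y(2) similar_mat_sym[OF x(1)]])
    then have "jordan_nf y (map (\<lambda>k. (k, 0)) \<nu>)"
      using x(2) similar_mat_trans unfolding jordan_nf_def by blast
    then show "y \<in> nilpotent_orbit N \<nu>" using y(1) unfolding nilpotent_orbit_def by blast
  qed
  from this[OF assms] this[OF assms(2,1)] show ?thesis by blast
qed

text \<open>The definition supplies some partition. A generic point also has the type read off from
  \<open>T\<close> at \<open>k = N\<close>, and orbits that share a point coincide. The case
  \<open>N = 0\<close> is separate because block sizes start at 1.\<close>

lemma orbital_variety_component:
  assumes "orbital_variety N V" "associated_tableau N V T"
  shows "irreducible_component
    (subtopology (zariski N) (nilpotent_orbit N (shape_upto N T) \<inter> strictly_upper N)) V"
proof -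
  from assms(1) obtain \<mu> where \<mu>: "is_partition N \<mu>"
    "irreducible_component (subtopology (zariski N) (nilpotent_orbit N \<mu> \<inter> strictly_upper N)) V"
    unfolding orbital_variety_def by blast
  have V: "V \<subseteq> nilpotent_orbit N \<mu>"
    using \<mu>(2) unfolding irreducible_component_def irreducible_in_subtopology by blast
  have "nilpotent_orbit N \<mu> = nilpotent_orbit N (shape_upto N T)"
  proof (cases "N = 0")
    case True
    have "\<mu> = []" using \<mu>(1) True unfolding is_partition_def by (cases \<mu>) auto
    moreover have "standard_tableau N T" using assms(2) unfolding associated_tableau_def by blast
    then have "[] \<notin> set T" "concat T = []" using True unfolding standard_tableau_def by auto
    then have "T = []" by (cases T) auto
    ultimately show ?thesis by (simp add: shape_upto_def)
  next
    case False
    obtain x where x: "x \<in> V" "has_tableau N T x"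
      using generically_ex[OF generically_has_tableau[OF assms]] by blast
    then have "x \<in> nilpotent_orbit N \<mu>" using V by blast
    then have "upper_left N x = x" unfolding nilpotent_orbit_def
      by (intro eq_matI) auto
    then have "x \<in> nilpotent_orbit N (shape_upto N T)"
      using x(2) False unfolding has_tableau_def by (metis One_nat_def Suc_leI atLeastAtMost_iff le_refl neq0_conv)
    with \<open>x \<in> nilpotent_orbit N \<mu>\<close> show ?thesis by (rule nilpotent_orbit_eqI)
  qed
  then show ?thesis using \<mu>(2) by simp
qed

text \<open>The trace of the closure of \<open>V'\<close> on the orbit is irreducible and contains
  \<open>V'\<close>, so it equals \<open>V'\<close> by maximality. It contains \<open>V\<close> too,
  and maximality of \<open>V\<close> finishes.\<close>

lemma same_tableau_closure_eq:
  assumes "orbital_variety N V" "associated_tableau N V T"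
    and "orbital_variety N V'" "associated_tableau N V' T"
    and "V \<subseteq> zariski N closure_of V'"
  shows "V = V'"
proof -
  let ?O = "nilpotent_orbit N (shape_upto N T) \<inter> strictly_upper N"
  have V: "V \<subseteq> ?O" "\<And>S. irreducible_in (zariski N) S \<Longrightarrow> S \<subseteq> ?O \<Longrightarrow> V \<subseteq> S \<Longrightarrow> S = V"
    and V': "V' \<subseteq> ?O" "irreducible_in (zariski N) V'"
      "\<And>S. irreducible_in (zariski N) S \<Longrightarrow> S \<subseteq> ?O \<Longrightarrow> V' \<subseteq> S \<Longrightarrow> S = V'"
    using orbital_variety_component[OF assms(1,2)] orbital_variety_component[OF assms(3,4)]
    unfolding irreducible_component_def irreducible_in_subtopology by blast+
  let ?W = "zariski N closure_of V' \<inter> ?O"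
  have "V' \<subseteq> zariski N closure_of V'"
    using V'(2) unfolding irreducible_in_iff by (intro closure_of_subset) blast
  then have sub: "V' \<subseteq> ?W" using V'(1) by blast
  have "irreducible_in (zariski N) ?W"
    by (rule irreducible_in_between_closure[OF V'(2) sub]) blast
  then have "?W = V'" by (rule V'(3)) (use sub in auto)
  then have "V \<subseteq> V'" using V(1) assms(5) by blast
  then show ?thesis using V(2)[OF V'(2,1)] by simp
qed

theorem lemma1:
  fixes N :: nat
    and V V\<^sub>R :: "complex mat set"
    and T T\<^sub>R :: "nat list list"
  assumes "hypersurface_orbital_variety N V"
    and "richardson_orbital_variety N (tau_invariant N V) V\<^sub>R"
    and "associated_tableau N V T"
    and "associated_tableau N V\<^sub>R T\<^sub>R"
  shows "\<exists>i \<ge> 1. \<exists>C \<in> tau_chains N (tau_invariant N V\<^sub>R).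
           card C = i \<and> i \<le> length T\<^sub>R \<and> Max C \<in> set (T\<^sub>R ! (i - 1)) \<and>
           T = move_box (Max C) i T\<^sub>R"
proof -
  define \<tau> where "\<tau> = tau_invariant N V"
  let ?m = "nilradical N \<tau>" and ?X = "subtopology (zariski N) (nilradical N \<tau>)"
  have V: "orbital_variety N V" and hyper: "hypersurface_in ?X (zariski N closure_of V)"
    using assms(1) unfolding hypersurface_orbital_variety_def \<tau>_def by blast+
  have R: "orbital_variety N V\<^sub>R" and tauR: "\<tau> = tau_invariant N V\<^sub>R"
    and clR: "zariski N closure_of V\<^sub>R = ?m"
    using assms(2) unfolding richardson_orbital_variety_def \<tau>_def by blast+
  have m_closed: "closedin (zariski N) ?m" unfolding clR[symmetric] by (rule closedin_closure_of)
  have dense: "V' \<subseteq> zariski N closure_of V'" if "orbital_variety N V'" for V'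
    using orbital_variety_irreducible[OF that] unfolding irreducible_in_iff
    by (intro closure_of_subset) blast
  have m_irr: "irreducible_in (zariski N) ?m"
    using irreducible_in_between_closure[OF orbital_variety_irreducible[OF R] dense[OF R] order_refl]
    unfolding clR .
  have clV: "zariski N closure_of V \<subseteq> ?m"
    using hyper closedin_subset[of ?X] unfolding hypersurface_in_def by auto
  interpret R: orbital_tableau N V\<^sub>R T\<^sub>R \<tau>
    using R assms(4) tauR dense[OF R] clR by unfold_locales auto
  interpret H: hypersurface_tableau N V T \<tau>
    using V assms(3) dense[OF V] clV hyper m_irr m_closed \<tau>_def by unfold_locales auto
  have rowR: "row_of T\<^sub>R (Suc k) = chain_pos \<tau> (Suc k)" if "k < N" for k
    by (rule R.row_of_dense[OF clR that])
  have rowT: "chain_pos \<tau> (Suc k) \<le> row_of T (Suc k)" if "k < N" for k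
    by (rule H.chain_pos_le_row) (use that in simp)
  have "\<exists>k<N. chain_pos \<tau> (Suc k) < row_of T (Suc k)"
  proof (rule ccontr)
    assume no: "\<not> ?thesis"
    have "row_of T k = row_of T\<^sub>R k" if "k \<in> {1..N}" for k
    proof -
      obtain j where "k = Suc j" "j < N" using \<open>k \<in> {1..N}\<close> by (cases k) auto
      then show ?thesis using no rowR[of j] rowT[of j] by (metis le_neq_implies_less)
    qed
    then have "T = T\<^sub>R" by (rule tableau_eqI[OF H.std R.std])
    then have "V = V\<^sub>R"
      using same_tableau_closure_eq[OF V assms(3) R] assms(4) clR H.sub by simp
    moreover have "topspace ?X = ?m"
      using closedin_subset[OF m_closed] by (simp add: Int_absorb1)
    ultimately show False using hypersurface_in_neq_topspace[OF hyper] clR by simp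
  qed
  then obtain k where k: "k < N" "chain_pos \<tau> (Suc k) < row_of T (Suc k)" by blast
  let ?s = "chain_pos \<tau> (Suc k)"
  have only: "row_of T (Suc j) = chain_pos \<tau> (Suc j)" if "j < N" "j \<noteq> k" for j
  proof (rule ccontr)
    assume "row_of T (Suc j) \<noteq> chain_pos \<tau> (Suc j)"
    then have "chain_pos \<tau> (Suc j) < row_of T (Suc j)" using rowT[OF that(1)] by linarith
    then show False
      using H.excess_unique[of j k] H.excess_unique[of k j] k that by (cases j k rule: linorder_cases) auto
  qed
  have rowk: "row_of T (Suc k) = Suc ?s" using H.excess_le_Suc[OF k(1)] k(2) by linarith
  \<comment> \<open>Otherwise the next entry would continue the chain without excess, so it would
    stand in the same row as \<open>Suc k\<close>, against \<open>row_of_descent\<close>.\<close>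
  have last: "Suc k \<notin> \<tau>"
  proof
    assume in_tau: "Suc k \<in> \<tau>"
    then have "Suc k < N" using H.tau_bounds by blast
    then have "row_of T (Suc (Suc k)) = Suc ?s" using only[of "Suc k"] in_tau by simp
    then show False using H.row_of_descent[OF in_tau] rowk by simp
  qed
  have mN: "Suc k \<in> {1..N}" using k(1) by simp
  \<comment> \<open>The chain position counts from 0, so \<open>Suc ?s\<close> is at once the length
    of this chain and the row of its last element in \<open>T\<^sub>R\<close>, counted from
    1.\<close>
  let ?C = "{Suc k - ?s..Suc k}"
  have "T = move_box (Suc k) (Suc (row_of T\<^sub>R (Suc k))) T\<^sub>R"
  proof (rule tableau_eq_move_box[OF H.std R.std mN])
    show "row_of T (Suc k) = Suc (row_of T\<^sub>R (Suc k))" using rowk rowR[OF k(1)] by simp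
    fix j assume j: "j \<in> {1..N}" "j \<noteq> Suc k"
    then obtain i where "j = Suc i" "i < N" by (cases j) auto
    then show "row_of T j = row_of T\<^sub>R j" using only[of i] rowR[of i] j by simp
  qed
  then have move: "T = move_box (Suc k) (Suc ?s) T\<^sub>R" unfolding rowR[OF k(1)] .
  have chain: "?C \<in> tau_chains N (tau_invariant N V\<^sub>R)"
    unfolding tauR[symmetric]
    by (rule chain_in_tau_chains[OF _ mN last]) (use H.tau_bounds in auto)
  have sk: "?s \<le> k" by (rule chain_pos_le[OF H.zero_notin_tau])
  have card: "card ?C = Suc ?s" using sk by (simp add: Suc_diff_le del: chain_pos.simps)
  have Max: "Max ?C = Suc k" by (rule Max_eqI) auto
  have "Suc ?s \<le> length T\<^sub>R" "Suc k \<in> set (T\<^sub>R ! (Suc ?s - 1))"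
    using R.row_of[OF mN] unfolding rowR[OF k(1)] by simp_all
  then show ?thesis using move chain card Max
    by (intro exI[of _ "Suc ?s"] conjI bexI[of _ ?C]) simp_all
qed

end
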